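(* Let $\xi\in(\ell^1)^*$. The following conditions are equivalent. (i) $\xi$ is $\infty$-regular. (ii) $\xi_{a_\infty}=O(\xi)$. (iii) $\alpha(\xi)<-1$, i.e., there are constants $C>0$ and $p>1$ for which $\xi_n\le C\left(\frac mn\right)^p\xi_m$ for all integers $n\ge m$. (iv) $\xi_{a_\infty}$ is $\infty$-regular. (v) $\inf_n\frac{(\xi_{a_\infty})_n}{(\xi_{a_\infty})_{kn}}>k$ for some integer $k>1$. (v$'$) $\inf_n\frac{(\xi_{a_\infty})_n}{(\xi_{a_\infty})_{kn}}>k$ for all integers $k>1$. (v$''$) $\inf_n\frac{\xi_n}{(\xi_{a_\infty})_{kn}}>0$ for all integers $k>1$. (v$'''$) $\inf_n\frac{\xi_n}{(\xi_{a_\infty})_{kn}}>0$ for some integer $k>1$. (vi) $\sup_k\inf_n\frac{(\xi_{a_\infty})_n}{k(\xi_{a_\infty})_{kn}}=\infty$.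
   Context: $\mathrm{c}_{\mathrm o}^*$ is the set of nonincreasing sequences of nonnegative reals (indexed by $n\ge1$) converging to $0$, and $(\ell^1)^*:=\ell^1\cap \mathrm{c}_{\mathrm o}^*$. For $\xi\in(\ell^1)^*$, $\xi_{a_\infty}:=\langle\frac1n\sum_{j=n+1}^\infty\xi_j\rangle_n\in \mathrm{c}_{\mathrm o}^*$. The Matuszewska index $\alpha(\xi)$ is $\alpha(\xi)=\inf\{\gamma\mid\exists\,C>0\text{ such that }\xi_n\le C(\frac nm)^\gamma\xi_m\text{ for all }n\ge m\}$ (for positive sequences this equals $\lim_n\frac{\log\overline\xi_n}{\log n}$, where $\overline\xi_n=\sup_k\frac{\xi_{kn}}{\xi_k}$). Let $H$ be a complex separable infinite-dimensional Hilbert space. For a proper two-sided ideal $I$ of $B(H)$ (necessarily consisting of compact operators), $\Sigma(I)=\{s(X)\mid X\in I\}\subset \mathrm{c}_{\mathrm o}^*$, with $s(X)$ the sequence of $s$-numbers (singular values in decreasing order, completed by zeros). Ideals are determined by their characteristic sets $\Sigma(I)$. $(\xi)$ denotes the principal ideal generated by $\mathrm{diag}\,\xi$: $\eta\in\Sigma((\xi))$ iff $\eta\in \mathrm{c}_{\mathrm o}^*$ and $\eta=O(D_m\xi)$ for some $m\in\mathbb N$, where $D_m\xi$ is $\xi$ with each entry repeated $m$ times. For $I\ne\{0\}$, ${}_{a_\infty}I$ is the ideal with $\Sigma({}_{a_\infty}I)=\{\eta\in(\ell^1)^*\mid\eta_{a_\infty}\in\Sigma(I)\}$. A sequence $\xi\in(\ell^1)^*$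 is regular at infinity ($\infty$-regular) if $(\xi)={}_{a_\infty}(\xi)$; in particular an $\infty$-regular sequence is summable (so (iv) includes $\xi_{a_\infty}\in\ell^1$). Conventions for degenerate sequences: in the infima, quotients with zero denominator are interpreted as $+\infty$, and the zero sequence is regarded as $\infty$-regular. *)

theory Defs
  imports "HOL-Analysis.Analysis" "HOL-Library.Landau_Symbols"
begin

text \<open>A sequence \<open>(\<xi>\<^sub>n)\<close> with \<open>n \<ge> 1\<close> is a function \<open>\<xi> :: nat \<Rightarrow> real\<close> whose value at \<open>0\<close>
  is irrelevant: no notion below depends on it. Orthonormal sequences are treated likewise.\<close>

definition c0_star :: "(nat \<Rightarrow> real) set" where
  "c0_star = {\<xi>. (\<forall>n\<ge>1. 0 \<le> \<xi> n) \<and> (\<forall>m\<ge>1. \<forall>n\<ge>m. \<xi> n \<le> \<xi> m) \<and> \<xi> \<longlonglongrightarrow> 0}"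

definition l1_star :: "(nat \<Rightarrow> real) set" where
  "l1_star = {\<xi> \<in> c0_star. summable \<xi>}"

definition am_inf :: "(nat \<Rightarrow> real) \<Rightarrow> nat \<Rightarrow> real" where
  "am_inf \<xi> n = (\<Sum>j. \<xi> (j + Suc n)) / real n"

text \<open>Extended-real valued, because the infimum is \<open>-\<infinity>\<close> for rapidly decreasing sequences.\<close>

definition matuszewska_alpha :: "(nat \<Rightarrow> real) \<Rightarrow> ereal" where
  "matuszewska_alpha \<xi> =
     (INF \<gamma> \<in> {\<gamma> :: real. \<exists>C>0. \<forall>m\<ge>1. \<forall>n\<ge>m. \<xi> n \<le> C * (real n / real m) powr \<gamma> * \<xi> m}. ereal \<gamma>)"

text \<open>Quotient with the convention that a zero denominator gives \<open>+\<infinity>\<close>, also for \<open>0 / 0\<close>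
  (the library's \<open>ereal\<close> division has \<open>0 / 0 = 0\<close>).\<close>

definition equot :: "real \<Rightarrow> real \<Rightarrow> ereal" where
  "equot x y = (if y = 0 then \<infinity> else ereal (x / y))"

text \<open>Complex Hilbert spaces; the inner product is linear in its second argument.\<close>

class complex_hilbert = banach +
  fixes scaleC :: "complex \<Rightarrow> 'a \<Rightarrow> 'a" (infixr \<open>*\<^sub>C\<close> 75)
    and cinner :: "'a \<Rightarrow> 'a \<Rightarrow> complex"
  assumes scaleC_add_right: "c *\<^sub>C (x + y) = c *\<^sub>C x + c *\<^sub>C y"
    and scaleC_add_left: "(c + d) *\<^sub>C x = c *\<^sub>C x + d *\<^sub>C x"
    and scaleC_scaleC: "c *\<^sub>C d *\<^sub>C x = (c * d) *\<^sub>C x"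
    and scaleR_scaleC: "r *\<^sub>R x = complex_of_real r *\<^sub>C x"
    and cinner_commute: "cinner x y = cnj (cinner y x)"
    and cinner_add_right: "cinner x (y + z) = cinner x y + cinner x z"
    and cinner_scaleC_right: "cinner x (c *\<^sub>C y) = c * cinner x y"
    and cinner_self: "cinner x x = complex_of_real ((norm x)\<^sup>2)"

definition orthonormal_seq :: "(nat \<Rightarrow> 'h::complex_hilbert) \<Rightarrow> bool" where
  "orthonormal_seq e \<longleftrightarrow> (\<forall>m\<ge>1. \<forall>n\<ge>1. cinner (e m) (e n) = (if m = n then 1 else 0))"

text \<open>A space has such a basis iff it is separable and infinite-dimensional.\<close>

definition orthonormal_basis :: "(nat \<Rightarrow> 'h::complex_hilbert) \<Rightarrow> bool" where
  "orthonormal_basis e \<longleftrightarrow>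
     orthonormal_seq e \<and> (\<forall>v. (\<forall>n\<ge>1. cinner (e n) v = 0) \<longrightarrow> v = 0)"

text \<open>\<open>B(H)\<close>: elements of the library type \<open>'h \<Rightarrow>\<^sub>L 'h\<close> are only real-linear.\<close>

definition bounded_ops :: "('h::complex_hilbert \<Rightarrow>\<^sub>L 'h) set" where
  "bounded_ops = {T. \<forall>c x. blinfun_apply T (c *\<^sub>C x) = c *\<^sub>C blinfun_apply T x}"

definition two_sided_ideal :: "('h::complex_hilbert \<Rightarrow>\<^sub>L 'h) set \<Rightarrow> bool" where
  "two_sided_ideal I \<longleftrightarrow> I \<subseteq> bounded_ops \<and> 0 \<in> I \<and> (\<forall>X\<in>I. \<forall>Y\<in>I. X + Y \<in> I) \<and>
     (\<forall>X\<in>I. \<forall>A\<in>bounded_ops. A o\<^sub>L X \<in> I \<and> X o\<^sub>L A \<in> I)"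

definition proper_ideal :: "('h::complex_hilbert \<Rightarrow>\<^sub>L 'h) set \<Rightarrow> bool" where
  "proper_ideal I \<longleftrightarrow> two_sided_ideal I \<and> I \<noteq> bounded_ops"

text \<open>\<open>s(X) = \<sigma>\<close> for a compact operator \<open>X\<close>: the squares of the \<open>\<sigma>\<^sub>n\<close> are the eigenvalues of
  \<open>X\<^sup>*X\<close>, repeated according to multiplicity, in nonincreasing order and completed by zeros
  if there are only finitely many nonzero ones. The eigenvalue equation
  \<open>X\<^sup>*X e\<^sub>n = \<sigma>\<^sub>n\<^sup>2 e\<^sub>n\<close> is written weakly, to avoid the adjoint; the last clause says
  that no nonzero eigenvalue is missed (if \<open>X\<close> has infinite rank, the zero eigenvalue
  does not occur in \<open>\<sigma>\<close>).\<close>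

definition s_numbers :: "('h::complex_hilbert \<Rightarrow>\<^sub>L 'h) \<Rightarrow> (nat \<Rightarrow> real) \<Rightarrow> bool" where
  "s_numbers X \<sigma> \<longleftrightarrow> \<sigma> \<in> c0_star \<and>
     (\<exists>e. orthonormal_seq e \<and>
        (\<forall>n\<ge>1. \<forall>v. cinner (blinfun_apply X (e n)) (blinfun_apply X v)
                     = complex_of_real ((\<sigma> n)\<^sup>2) * cinner (e n) v) \<and>
        (\<forall>v. (\<forall>n\<ge>1. cinner (e n) v = 0) \<longrightarrow> blinfun_apply X v = 0))"

definition char_set :: "('h::complex_hilbert \<Rightarrow>\<^sub>L 'h) set \<Rightarrow> (nat \<Rightarrow> real) set" where
  "char_set I = {\<sigma>. \<exists>X\<in>I. s_numbers X \<sigma>}"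

definition diag :: "(nat \<Rightarrow> 'h::complex_hilbert) \<Rightarrow> (nat \<Rightarrow> real) \<Rightarrow> 'h \<Rightarrow>\<^sub>L 'h" where
  "diag b \<xi> = Blinfun (\<lambda>v. \<Sum>n. (complex_of_real (\<xi> (Suc n)) * cinner (b (Suc n)) v) *\<^sub>C b (Suc n))"

definition principal :: "(nat \<Rightarrow> 'h::complex_hilbert) \<Rightarrow> (nat \<Rightarrow> real) \<Rightarrow> ('h \<Rightarrow>\<^sub>L 'h) set" where
  "principal b \<xi> = two_sided_ideal hull {diag b \<xi>}"

text \<open>\<open>J = \<^sub>a\<^sub>\<infinity>I\<close>, for nonzero \<open>I\<close>. Proper ideals are determined by their characteristic sets, so
  there is at most one such \<open>J\<close>.\<close>

definition is_am_inf_ideal ::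
  "('h::complex_hilbert \<Rightarrow>\<^sub>L 'h) set \<Rightarrow> ('h \<Rightarrow>\<^sub>L 'h) set \<Rightarrow> bool" where
  "is_am_inf_ideal I J \<longleftrightarrow>
     proper_ideal J \<and> char_set J = {\<eta> \<in> l1_star. am_inf \<eta> \<in> char_set I}"

text \<open>The zero sequence, whose principal ideal is \<open>{0}\<close>, is \<open>\<infinity>\<close>-regular by convention.\<close>

definition infty_regular :: "(nat \<Rightarrow> 'h::complex_hilbert) \<Rightarrow> (nat \<Rightarrow> real) \<Rightarrow> bool" where
  "infty_regular b \<xi> \<longleftrightarrow> \<xi> \<in> l1_star \<and>
     ((\<forall>n\<ge>1. \<xi> n = 0) \<or> is_am_inf_ideal (principal b \<xi>) (principal b \<xi>))"

end

theory Submission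
  imports Defs
begin

text \<open>Write \<open>T\<^sub>n = \<Sum>\<^bsub>j>n\<^esub> \<xi>\<^sub>j\<close>, so that \<open>am_inf \<xi> n = T\<^sub>n / n\<close>. Two facts carry the theorem.

  The first is about sequences: \<open>T\<^sub>n\<close> is \<open>O(n \<xi>\<^sub>n)\<close> if and only if tails decay geometrically under dilation, that is
  \<open>T\<^bsub>kn\<^esub> \<le> q T\<^sub>n\<close> with \<open>q < 1\<close>, for one or equivalently for every \<open>k > 1\<close>
  (\<open>tail_decay_of_tail_bounded\<close>, \<open>tail_bounded_of_tail_decay\<close>). The reason is that \<open>T\<^sub>n - T\<^bsub>kn\<^esub>\<close> is a sum of
  \<open>(k - 1) n\<close> terms between \<open>\<xi>\<^bsub>kn\<^esub>\<close> and \<open>\<xi>\<^sub>n\<close>. The infima and the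
  supremum over quotients of the means at \<open>n\<close> and \<open>k n\<close> express such decay, because these quotients equal
  \<open>k T\<^sub>n / T\<^bsub>kn\<^esub>\<close>; the bounds of \<open>\<xi>\<^sub>n\<close> against the mean at \<open>k n\<close> look weaker but imply decay for \<open>2 k\<close> in place of
  \<open>k\<close> (\<open>tail_decay_of_dilated_bound\<close>). Iterating the decay gives the power bound, and with it the bound on the
  Matuszewska index; conversely a power bound with exponent \<open>p > 1\<close> makes the tail sum small on long blocks.
  The same iteration, applied to the tails of \<open>am_inf \<xi>\<close>, shows that \<open>\<xi>\<close> has bounded tails as soon as \<open>am_inf \<xi>\<close>
  does (\<open>tail_bounded_of_am_inf\<close>).

  The second is about operators: for \<open>\<xi>\<^sub>1 > 0\<close> the characteristic set of the principal ideal \<open>(\<xi>)\<close> consists of the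
  \<open>\<sigma>\<close> in \<open>c0_star\<close> that are \<open>O(D\<^sub>m \<xi>)\<close> for some \<open>m\<close> (\<open>char_set_principal\<close>). Every operator of \<open>(\<xi>)\<close> is
  bounded by \<open>C \<xi>\<^bsub>n+1\<^esub>\<close> on a subspace of codimension \<open>m n\<close>, because such operators form an ideal containing
  \<open>diag b \<xi>\<close>, and this controls the \<open>s\<close>-numbers. In the other direction \<open>diag b \<sigma>\<close> is a sum of \<open>m\<close> products
  of \<open>diag b \<xi>\<close> with bounded operators. Equality of the two characteristic sets in the definition of regularity then
  becomes a statement about sequences, and reduces to \<open>am_inf \<xi> \<in> O(\<xi>)\<close>
  (\<open>infty_regular_iff_tail_bounded\<close>).\<close>

section \<open>Orthonormal sequences\<close>

lemma cinner_add_left: "cinner (x + y) z = cinner x z + cinner y (z :: 'h::complex_hilbert)"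
  by (metis cinner_add_right cinner_commute complex_cnj_add)

lemma cinner_scaleC_left: "cinner (a *\<^sub>C x) y = cnj a * cinner x (y :: 'h::complex_hilbert)"
  by (metis cinner_scaleC_right cinner_commute complex_cnj_mult)

lemma cinner_zero_right [simp]: "cinner x (0 :: 'h::complex_hilbert) = 0"
  using cinner_add_right[of x 0 0] by simp

lemma cinner_zero_left [simp]: "cinner 0 (x :: 'h::complex_hilbert) = 0"
  using cinner_add_left[of 0 0 x] by simp

lemma cinner_diff_right: "cinner x (y - z) = cinner x y - cinner x (z :: 'h::complex_hilbert)"
  using cinner_add_right[of x "y - z" z] by simp

lemma cinner_sum_right: "cinner x (\<Sum>i\<in>I. g i) = (\<Sum>i\<in>I. cinner x (g i :: 'h::complex_hilbert))"
  by (induction I rule: infinite_finite_induct) (auto simp: cinner_add_right)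

lemma cinner_sum_left: "cinner (\<Sum>i\<in>I. g i) x = (\<Sum>i\<in>I. cinner (g i) (x :: 'h::complex_hilbert))"
  by (induction I rule: infinite_finite_induct) (auto simp: cinner_add_left)

lemma scaleC_0_right [simp]: "a *\<^sub>C (0 :: 'h::complex_hilbert) = 0"
  using scaleC_add_right[of a 0 "0 :: 'h"] by simp

lemma norm_scaleC: "norm (a *\<^sub>C (x :: 'h::complex_hilbert)) = cmod a * norm x"
proof -
  have "complex_of_real ((norm (a *\<^sub>C x))\<^sup>2) = (a * cnj a) * cinner x x"
    by (simp only: cinner_self[symmetric] cinner_scaleC_left cinner_scaleC_right mult_ac)
  also have "\<dots> = complex_of_real ((cmod a * norm x)\<^sup>2)"
    unfolding complex_norm_square[symmetric] cinner_self by (simp add: power_mult_distrib)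
  finally have "(norm (a *\<^sub>C x))\<^sup>2 = (cmod a * norm x)\<^sup>2"
    using of_real_eq_iff by blast
  then show ?thesis by simp
qed

lemma bounded_ops_scaleC: "X \<in> bounded_ops \<Longrightarrow> blinfun_apply X (a *\<^sub>C v) = a *\<^sub>C blinfun_apply X v"
  unfolding bounded_ops_def by blast

text \<open>Indices start at \<open>0\<close> here, so that the vector with index \<open>n\<close> has exactly \<open>n\<close> predecessors, the
  codimension to be paired with it, and repeating entries \<open>m\<close> times is the reindexing \<open>i \<mapsto> i div m\<close>.\<close>

definition orthonormal :: "(nat \<Rightarrow> 'h::complex_hilbert) \<Rightarrow> bool" where
  "orthonormal e \<longleftrightarrow> (\<forall>m n. cinner (e m) (e n) = (if m = n then 1 else 0))"

lemma orthonormal_Suc: "orthonormal_seq e \<Longrightarrow> orthonormal (\<lambda>n. e (Suc n))"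
  unfolding orthonormal_seq_def orthonormal_def by auto

lemma cinner_orthonormal_sum:
  assumes "orthonormal e" "finite I"
  shows "cinner (e n) (\<Sum>i\<in>I. a i *\<^sub>C e i) = (if n \<in> I then a n else 0)"
  using assms
  by (simp add: cinner_sum_right cinner_scaleC_right orthonormal_def if_distrib[of "(*) _"] cong: if_cong)

lemma norm_orthonormal_sum:
  assumes "orthonormal e" "finite I"
  shows "(norm (\<Sum>i\<in>I. a i *\<^sub>C e i))\<^sup>2 = (\<Sum>i\<in>I. (cmod (a i))\<^sup>2)"
proof -
  have "complex_of_real ((norm (\<Sum>i\<in>I. a i *\<^sub>C e i))\<^sup>2) = (\<Sum>i\<in>I. cnj (a i) * a i)"
    unfolding cinner_self[symmetric] cinner_sum_left
    using assms by (simp add: cinner_scaleC_left cinner_orthonormal_sum)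
  also have "\<dots> = complex_of_real (\<Sum>i\<in>I. (cmod (a i))\<^sup>2)"
    unfolding of_real_sum complex_norm_square by (simp add: mult.commute)
  finally show ?thesis using of_real_eq_iff by blast
qed

text \<open>Pythagoras for \<open>v\<close> and its projection onto the span. The case of a single index gives
  the continuity of \<open>\<langle>e\<^sub>n, \<cdot>\<rangle>\<close>.\<close>

lemma bessel:
  assumes "orthonormal e" "finite I"
  shows "(\<Sum>i\<in>I. (cmod (cinner (e i) v))\<^sup>2) \<le> (norm v)\<^sup>2"
proof -
  define p where "p = (\<Sum>i\<in>I. cinner (e i) v *\<^sub>C e i)"
  have "cinner (e i) (v - p) = 0" if "i \<in> I" for i
    using cinner_orthonormal_sum[OF assms, of i "\<lambda>i. cinner (e i) v"] that
    by (simp add: cinner_diff_right p_def)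
  then have orth: "cinner p (v - p) = 0"
    by (subst p_def) (simp add: cinner_sum_left cinner_scaleC_left)
  have "cinner v v = cinner (p + (v - p)) (p + (v - p))" by simp
  also have "\<dots> = cinner p p + cinner (v - p) (v - p)"
    using orth cinner_commute[of "v - p" p] by (simp only: cinner_add_left cinner_add_right) simp
  finally have "complex_of_real ((norm v)\<^sup>2) = complex_of_real ((norm p)\<^sup>2 + (norm (v - p))\<^sup>2)"
    unfolding cinner_self by simp
  then have "(norm v)\<^sup>2 = (norm p)\<^sup>2 + (norm (v - p))\<^sup>2"
    using of_real_eq_iff by blast
  then show ?thesis
    using norm_orthonormal_sum[OF assms] unfolding p_def by simp
qed

lemma cmod_cinner_le:
  assumes "orthonormal e"
  shows "cmod (cinner (e n) v) \<le> norm v"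
  using bessel[OF assms, of "{n}" v] by (simp add: power2_le_iff_abs_le)

lemma bounded_linear_cinner:
  assumes "orthonormal e"
  shows "bounded_linear (cinner (e n))"
proof (rule bounded_linear_intro[where K = 1])
  show "cinner (e n) (r *\<^sub>R x) = r *\<^sub>R cinner (e n) x" for r x
    by (simp add: scaleR_scaleC cinner_scaleC_right scaleR_conv_of_real)
qed (use cmod_cinner_le[OF assms] in \<open>auto simp: cinner_add_right\<close>)

text \<open>Partial sums are Cauchy because their squared norms are partial sums of \<open>\<Sum> \<bar>d\<^sub>i\<bar>\<^sup>2\<close>.\<close>

lemma orthonormal_series:
  assumes e: "orthonormal e" and K: "0 \<le> K" and bd: "\<And>N. (\<Sum>i<N. (cmod (d i))\<^sup>2) \<le> K\<^sup>2"
  shows "summable (\<lambda>i. d i *\<^sub>C e i)" "norm (\<Sum>i. d i *\<^sub>C e i) \<le> K"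
    "cinner (e n) (\<Sum>i. d i *\<^sub>C e i) = d n"
proof -
  have sq: "summable (\<lambda>i. (cmod (d i))\<^sup>2)"
    using bd by (intro summableI_nonneg_bounded) auto
  show s: "summable (\<lambda>i. d i *\<^sub>C e i)"
    unfolding summable_Cauchy
  proof (intro allI impI)
    fix \<epsilon> :: real assume \<epsilon>: "\<epsilon> > 0"
    then obtain N where N: "\<And>m n. m \<ge> N \<Longrightarrow> norm (\<Sum>i=m..<n. (cmod (d i))\<^sup>2) < \<epsilon>\<^sup>2"
      using sq unfolding summable_Cauchy by (meson zero_less_power)
    have "norm (\<Sum>i=m..<n. d i *\<^sub>C e i) < \<epsilon>" if "m \<ge> N" for m n
    proof (rule power_less_imp_less_base)
      show "(norm (\<Sum>i=m..<n. d i *\<^sub>C e i))\<^sup>2 < \<epsilon>\<^sup>2"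
        using N[OF that, of n] by (simp add: norm_orthonormal_sum[OF e])
    qed (use \<epsilon> in simp)
    then show "\<exists>N. \<forall>m\<ge>N. \<forall>n. norm (\<Sum>i=m..<n. d i *\<^sub>C e i) < \<epsilon>" by blast
  qed
  have "norm (\<Sum>i<N. d i *\<^sub>C e i) \<le> K" for N
    using bd[of N] by (intro power2_le_imp_le[OF _ K]) (simp add: norm_orthonormal_sum[OF e])
  then show "norm (\<Sum>i. d i *\<^sub>C e i) \<le> K"
    by (intro LIMSEQ_le_const2[OF tendsto_norm[OF summable_LIMSEQ[OF s]]]) auto
  have "cinner (e n) (\<Sum>i. d i *\<^sub>C e i) = (\<Sum>i. cinner (e n) (d i *\<^sub>C e i))"
    by (rule bounded_linear.suminf[OF bounded_linear_cinner[OF e] s])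
  also have "\<dots> = (\<Sum>i. if i = n then d i else 0)"
    using e by (intro suminf_cong) (auto simp: cinner_scaleC_right orthonormal_def)
  finally show "cinner (e n) (\<Sum>i. d i *\<^sub>C e i) = d n"
    using sums_single[of n d, THEN sums_unique] by simp
qed

section \<open>Weighted composition operators\<close>

text \<open>The operator with \<open>\<langle>e\<^sub>n, T v\<rangle> = a\<^sub>n \<langle>e\<^bsub>f n\<^esub>, v\<rangle>\<close>. Diagonal operators are the case \<open>f = id\<close>;
  other choices of \<open>f\<close> compress a residue class of indices to all of \<open>\<nat>\<close> and spread it out again.\<close>

definition weighted_composition ::
  "(nat \<Rightarrow> 'h::complex_hilbert) \<Rightarrow> (nat \<Rightarrow> nat) \<Rightarrow> (nat \<Rightarrow> complex) \<Rightarrow> 'h \<Rightarrow>\<^sub>L 'h" where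
  "weighted_composition e f a = Blinfun (\<lambda>v. \<Sum>n. (a n * cinner (e (f n)) v) *\<^sub>C e n)"

text \<open>Injectivity of \<open>f\<close> where \<open>a\<close> does not vanish keeps every coefficient of \<open>v\<close> from being
  counted twice, so Bessel applies. The bound \<open>K\<close> is asked for only after multiplication by the coefficient of
  \<open>v\<close>: when \<open>v\<close> is orthogonal to the first \<open>n\<close> vectors, \<open>K\<close> can then be smaller than \<open>sup \<bar>a\<^sub>i\<bar>\<close>.\<close>

lemma weighted_coeff_bound:
  fixes f :: "nat \<Rightarrow> nat"
  assumes e: "orthonormal e" and inj: "inj_on f {n. a n \<noteq> 0}"
    and K: "\<And>n. cmod (a n * cinner (e (f n)) v) \<le> K * cmod (cinner (e (f n)) v)"
    and K0: "0 \<le> K"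
  shows "(\<Sum>n<N. (cmod (a n * cinner (e (f n)) v))\<^sup>2) \<le> (K * norm v)\<^sup>2"
proof -
  let ?S = "{n. n < N \<and> a n \<noteq> 0}"
  have "(\<Sum>n<N. (cmod (a n * cinner (e (f n)) v))\<^sup>2) = (\<Sum>n\<in>?S. (cmod (a n * cinner (e (f n)) v))\<^sup>2)"
    by (rule sum.mono_neutral_right) auto
  also have "\<dots> \<le> (\<Sum>n\<in>?S. K\<^sup>2 * (cmod (cinner (e (f n)) v))\<^sup>2)"
    unfolding power_mult_distrib[symmetric] by (intro sum_mono power_mono K) auto
  also have "\<dots> = K\<^sup>2 * (\<Sum>k\<in>f ` ?S. (cmod (cinner (e k) v))\<^sup>2)"
    unfolding sum_distrib_left[symmetric]
    using inj by (subst sum.reindex) (auto simp: inj_on_def)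
  also have "\<dots> \<le> K\<^sup>2 * (norm v)\<^sup>2"
    by (intro mult_left_mono bessel[OF e]) auto
  finally show ?thesis by (simp add: power_mult_distrib)
qed

lemma weighted_composition:
  assumes e: "orthonormal e" and inj: "inj_on f {n. a n \<noteq> 0}" and K: "\<And>n. cmod (a n) \<le> K"
  shows weighted_composition_apply:
      "blinfun_apply (weighted_composition e f a) v = (\<Sum>n. (a n * cinner (e (f n)) v) *\<^sub>C e n)"
    and weighted_composition_bounded_ops: "weighted_composition e f a \<in> bounded_ops"
    and cinner_weighted_composition:
      "cinner (e n) (blinfun_apply (weighted_composition e f a) v) = a n * cinner (e (f n)) v"
proof -
  let ?T = "\<lambda>v. \<Sum>n. (a n * cinner (e (f n)) v) *\<^sub>C e n"
  have K0: "0 \<le> K" using K[of 0] norm_ge_zero order_trans by blast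
  have bd: "(\<Sum>n<N. (cmod (a n * cinner (e (f n)) v))\<^sup>2) \<le> (K * norm v)\<^sup>2" for N v
    using K by (intro weighted_coeff_bound[OF e inj _ K0]) (auto simp: norm_mult intro: mult_right_mono)
  note ser = orthonormal_series[OF e _ bd]
  have K0v: "0 \<le> K * norm v" for v :: 'a using K0 by simp
  have sm: "summable (\<lambda>n. (a n * cinner (e (f n)) v) *\<^sub>C e n)" for v
    by (rule ser(1)[OF K0v])
  have add: "?T (x + y) = ?T x + ?T y" for x y
    unfolding suminf_add[OF sm sm]
    by (simp add: cinner_add_right distrib_left scaleC_add_left)
  have bl: "bounded_linear (\<lambda>v. c *\<^sub>C v)" for c :: complex and v :: 'a
    by (rule bounded_linear_intro[where K = "cmod c"])
       (auto simp: scaleC_add_right norm_scaleC scaleR_scaleC scaleC_scaleC mult_ac)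
  have scale: "?T (c *\<^sub>C x) = c *\<^sub>C ?T x" for c x
    unfolding bounded_linear.suminf[OF bl sm]
    by (simp add: cinner_scaleC_right scaleC_scaleC mult_ac)
  have "bounded_linear ?T"
    by (rule bounded_linear_intro[where K = K])
       (use add scale ser(2)[OF K0v] in \<open>auto simp: scaleR_scaleC mult.commute\<close>)
  then show app: "blinfun_apply (weighted_composition e f a) v = ?T v" for v
    unfolding weighted_composition_def by (simp add: bounded_linear_Blinfun_apply)
  show "weighted_composition e f a \<in> bounded_ops"
    unfolding bounded_ops_def using app scale by auto
  show "cinner (e n) (blinfun_apply (weighted_composition e f a) v) = a n * cinner (e (f n)) v"
    unfolding app by (rule ser(3)[OF K0v])
qed

definition total_orthonormal :: "(nat \<Rightarrow> 'h::complex_hilbert) \<Rightarrow> bool" where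
  "total_orthonormal e \<longleftrightarrow> orthonormal e \<and> (\<forall>v. (\<forall>n. cinner (e n) v = 0) \<longrightarrow> v = 0)"

lemma total_orthonormal_Suc:
  assumes "orthonormal_basis b"
  shows "total_orthonormal (\<lambda>n. b (Suc n))"
  using assms orthonormal_Suc unfolding orthonormal_basis_def total_orthonormal_def
  by (metis One_nat_def Suc_le_D)

lemma total_orthonormal_eqI:
  assumes "total_orthonormal e" "\<And>n. cinner (e n) u = cinner (e n) v"
  shows "u = v"
  using assms unfolding total_orthonormal_def
  by (metis cinner_diff_right eq_iff_diff_eq_0)

section \<open>Gelfand numbers\<close>

text \<open>A homogeneous system with fewer equations than unknowns, by eliminating one unknown per
  equation.\<close>

lemma nontrivial_solution:
  fixes M :: "'f \<Rightarrow> 'i \<Rightarrow> complex"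
  assumes "finite F" "finite I" "card F < card I"
  shows "\<exists>a. (\<exists>i\<in>I. a i \<noteq> 0) \<and> (\<forall>f\<in>F. (\<Sum>i\<in>I. a i * M f i) = 0)"
  using assms
proof (induction F arbitrary: M I rule: finite_induct)
  case empty
  then have "I \<noteq> {}" by auto
  then show ?case by (intro exI[of _ "\<lambda>_. 1"]) auto
next
  case (insert f F)
  show ?case
  proof (cases "\<forall>i\<in>I. M f i = 0")
    case True
    then show ?thesis using insert.IH[of I M] insert.prems insert.hyps by auto
  next
    case False
    then obtain k where k: "k \<in> I" "M f k \<noteq> 0" by blast
    define M' where "M' g i = M g i - M g k * M f i / M f k" for g i
    have "card F < card (I - {k})" using insert.prems insert.hyps k by simp
    then obtain a where a: "\<exists>i\<in>I - {k}. a i \<noteq> 0" "\<And>g. g \<in> F \<Longrightarrow> (\<Sum>i\<in>I - {k}. a i * M' g i) = 0"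
      using insert.IH[of "I - {k}" M'] insert.prems(1) by blast
    define s where "s = (\<Sum>i\<in>I - {k}. a i * M f i)"
    define a' where "a' = a(k := - s / M f k)"
    have split: "(\<Sum>i\<in>I. a' i * M g i) = - s / M f k * M g k + (\<Sum>i\<in>I - {k}. a i * M g i)" for g
      using insert.prems(1) k(1) by (subst sum.remove[of I k]) (auto simp: a'_def intro!: sum.cong)
    have "(\<Sum>i\<in>I. a' i * M g i) = 0" if g: "g \<in> F" for g
    proof -
      have "0 = (\<Sum>i\<in>I - {k}. a i * M g i) - (\<Sum>i\<in>I - {k}. M g k / M f k * (a i * M f i))"
        using a(2)[OF g] unfolding M'_def sum_subtractf[symmetric] by (simp add: algebra_simps)
      then show ?thesis unfolding split s_def sum_distrib_left[symmetric] by simp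
    qed
    moreover have "(\<Sum>i\<in>I. a' i * M f i) = 0" unfolding split using k by (simp add: s_def)
    moreover have "\<exists>i\<in>I. a' i \<noteq> 0" using a(1) by (auto simp: a'_def)
    ultimately show ?thesis by auto
  qed
qed

definition clinear_functional :: "('h::complex_hilbert \<Rightarrow> complex) \<Rightarrow> bool" where
  "clinear_functional f \<longleftrightarrow> (\<forall>x y. f (x + y) = f x + f y) \<and> (\<forall>a x. f (a *\<^sub>C x) = a * f x)"

lemma clinear_functional_sum:
  assumes "clinear_functional f"
  shows "f (\<Sum>i\<in>I. a i *\<^sub>C g i) = (\<Sum>i\<in>I. a i * f (g i))"
proof -
  have "f 0 = 0" using assms unfolding clinear_functional_def by (metis add_cancel_right_right add.right_neutral)
  then show ?thesis using assms unfolding clinear_functional_def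
    by (induction I rule: infinite_finite_induct) auto
qed

text \<open>The \<open>k\<close>-th Gelfand number of \<open>X\<close> is at most \<open>c\<close>: on the common kernel of \<open>k\<close> linear functionals,
  \<open>X\<close> has norm at most \<open>c\<close>. The lower bound below is pure linear algebra, so arbitrary linear functionals
  are admitted.\<close>

definition gelfand_le :: "('h::complex_hilbert \<Rightarrow>\<^sub>L 'h) \<Rightarrow> nat \<Rightarrow> real \<Rightarrow> bool" where
  "gelfand_le X k c \<longleftrightarrow> (\<exists>F. finite F \<and> card F \<le> k \<and> (\<forall>f\<in>F. clinear_functional f) \<and>
     (\<forall>v. (\<forall>f\<in>F. f v = 0) \<longrightarrow> norm (blinfun_apply X v) \<le> c * norm v))"

text \<open>The span of \<open>k + 1\<close> vectors meets the common kernel of \<open>k\<close> functionals in a nonzero vector.\<close>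

lemma gelfand_le_lower:
  assumes g: "gelfand_le X k c" and e: "orthonormal e"
    and low: "\<And>a. s * norm (\<Sum>i\<le>k. a i *\<^sub>C e i) \<le> norm (blinfun_apply X (\<Sum>i\<le>k. a i *\<^sub>C e i))"
  shows "s \<le> c"
proof -
  obtain F where F: "finite F" "card F \<le> k" "\<And>f. f \<in> F \<Longrightarrow> clinear_functional f"
    and X: "\<And>v. (\<forall>f\<in>F. f v = 0) \<Longrightarrow> norm (blinfun_apply X v) \<le> c * norm v"
    using g unfolding gelfand_le_def by blast
  obtain a where a: "\<exists>i\<in>{..k}. a i \<noteq> 0" "\<And>f. f \<in> F \<Longrightarrow> (\<Sum>i\<le>k. a i * f (e i)) = 0"
    using nontrivial_solution[of F "{..k}" "\<lambda>f i. f (e i)"] F(1,2) by (auto simp: less_Suc_eq_le)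
  let ?v = "\<Sum>i\<le>k. a i *\<^sub>C e i"
  obtain i where i: "i \<le> k" "a i \<noteq> 0" using a(1) by auto
  have "cinner (e i) ?v = a i" using i cinner_orthonormal_sum[OF e, of "{..k}" i a] by simp
  then have "?v \<noteq> 0" using i by auto
  moreover have "norm (blinfun_apply X ?v) \<le> c * norm ?v"
    by (rule X) (use F(3) a(2) in \<open>simp add: clinear_functional_sum\<close>)
  then have "s * norm ?v \<le> c * norm ?v" using low[of a] by linarith
  ultimately show ?thesis by simp
qed

lemma gelfand_le_add:
  assumes "gelfand_le X k c" "gelfand_le Y l d"
  shows "gelfand_le (X + Y) (k + l) (c + d)"
proof -
  obtain F where F: "finite F" "card F \<le> k" "\<forall>f\<in>F. clinear_functional f"
    and X: "\<And>v. (\<forall>f\<in>F. f v = 0) \<Longrightarrow> norm (blinfun_apply X v) \<le> c * norm v"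
    using assms(1) unfolding gelfand_le_def by blast
  obtain G where G: "finite G" "card G \<le> l" "\<forall>f\<in>G. clinear_functional f"
    and Y: "\<And>v. (\<forall>f\<in>G. f v = 0) \<Longrightarrow> norm (blinfun_apply Y v) \<le> d * norm v"
    using assms(2) unfolding gelfand_le_def by blast
  have "norm (blinfun_apply (X + Y) v) \<le> (c + d) * norm v" if "\<forall>f\<in>F \<union> G. f v = 0" for v
  proof -
    have "norm (blinfun_apply (X + Y) v) \<le> norm (blinfun_apply X v) + norm (blinfun_apply Y v)"
      by (simp add: blinfun.add_left norm_triangle_ineq)
    also have "\<dots> \<le> c * norm v + d * norm v" using that by (intro add_mono X Y) auto
    finally show ?thesis by (simp add: distrib_right)
  qed
  moreover have "card (F \<union> G) \<le> k + l" using F G card_Un_le[of F G] by linarith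
  ultimately show ?thesis unfolding gelfand_le_def using F G
    by (intro exI[of _ "F \<union> G"]) auto
qed

lemma gelfand_le_compose_left:
  assumes "gelfand_le X k c"
  shows "gelfand_le (A o\<^sub>L X) k (norm A * c)"
proof -
  have "norm (blinfun_apply (A o\<^sub>L X) v) \<le> norm A * c * norm v"
    if "norm (blinfun_apply X v) \<le> c * norm v" for v
    using norm_blinfun[of A "blinfun_apply X v"] mult_left_mono[OF that norm_ge_zero[of A]]
    by (simp add: mult.assoc)
  then show ?thesis using assms unfolding gelfand_le_def by meson
qed

lemma gelfand_le_compose_right:
  assumes "gelfand_le X k c" "0 \<le> c" and A: "A \<in> bounded_ops"
  shows "gelfand_le (X o\<^sub>L A) k (c * norm A)"
proof -
  obtain F where F: "finite F" "card F \<le> k" "\<forall>f\<in>F. clinear_functional f"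
    and X: "\<And>v. (\<forall>f\<in>F. f v = 0) \<Longrightarrow> norm (blinfun_apply X v) \<le> c * norm v"
    using assms(1) unfolding gelfand_le_def by blast
  let ?F = "(\<lambda>f v. f (blinfun_apply A v)) ` F"
  have "norm (blinfun_apply (X o\<^sub>L A) v) \<le> c * norm A * norm v" if "\<forall>f\<in>?F. f v = 0" for v
    using X[of "blinfun_apply A v"] that mult_left_mono[OF norm_blinfun[of A v] \<open>0 \<le> c\<close>]
    by (auto simp: mult.assoc)
  moreover have "\<forall>f\<in>?F. clinear_functional f"
    using F(3) A by (auto simp: clinear_functional_def blinfun.add_right bounded_ops_scaleC)
  moreover have "card ?F \<le> k" using F card_image_le le_trans by blast
  ultimately show ?thesis unfolding gelfand_le_def using F(1) by blast
qed

text \<open>The operators whose Gelfand numbers are \<open>O(D\<^sub>m x)\<close> for some \<open>m\<close>. Since Gelfand numbers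
  satisfy \<open>c\<^bsub>k+l\<^esub>(X + Y) \<le> c\<^sub>k(X) + c\<^sub>l(Y)\<close> and \<open>c\<^sub>k(A X B) \<le> \<parallel>A\<parallel> c\<^sub>k(X) \<parallel>B\<parallel>\<close>, it is an ideal, and it bounds
  the principal ideal from above.\<close>

definition gelfand_ideal :: "(nat \<Rightarrow> real) \<Rightarrow> ('h::complex_hilbert \<Rightarrow>\<^sub>L 'h) set" where
  "gelfand_ideal x = {X \<in> bounded_ops. \<exists>m C. 0 \<le> C \<and> (\<forall>n. gelfand_le X (m * n) (C * x n))}"

lemma bounded_ops_add: "X \<in> bounded_ops \<Longrightarrow> Y \<in> bounded_ops \<Longrightarrow> X + Y \<in> bounded_ops"
  unfolding bounded_ops_def by (simp add: blinfun.add_left scaleC_add_right)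

lemma bounded_ops_compose: "X \<in> bounded_ops \<Longrightarrow> Y \<in> bounded_ops \<Longrightarrow> X o\<^sub>L Y \<in> bounded_ops"
  unfolding bounded_ops_def by simp

lemma two_sided_ideal_gelfand_ideal:
  assumes x: "\<And>n. 0 \<le> x n"
  shows "two_sided_ideal (gelfand_ideal x)"
  unfolding two_sided_ideal_def
proof (intro conjI ballI)
  show "gelfand_ideal x \<subseteq> bounded_ops" unfolding gelfand_ideal_def by blast
  have "gelfand_le (0 :: 'a \<Rightarrow>\<^sub>L 'a) (0 * n) (0 * x n)" for n
    unfolding gelfand_le_def by (intro exI[of _ "{}"]) auto
  moreover have "(0 :: 'a \<Rightarrow>\<^sub>L 'a) \<in> bounded_ops" unfolding bounded_ops_def by simp
  ultimately show "(0 :: 'a \<Rightarrow>\<^sub>L 'a) \<in> gelfand_ideal x" unfolding gelfand_ideal_def by blast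
next
  fix X Y :: "'a \<Rightarrow>\<^sub>L 'a" assume X: "X \<in> gelfand_ideal x" and Y: "Y \<in> gelfand_ideal x"
  obtain m C where m: "0 \<le> C" "\<And>n. gelfand_le X (m * n) (C * x n)"
    using X unfolding gelfand_ideal_def by blast
  obtain l D where l: "0 \<le> D" "\<And>n. gelfand_le Y (l * n) (D * x n)"
    using Y unfolding gelfand_ideal_def by blast
  have "gelfand_le (X + Y) ((m + l) * n) ((C + D) * x n)" for n
    using gelfand_le_add[OF m(2) l(2)] by (simp add: distrib_right)
  moreover have "0 \<le> C + D" using m l by simp
  moreover have "X + Y \<in> bounded_ops"
    using X Y bounded_ops_add unfolding gelfand_ideal_def by blast
  ultimately show "X + Y \<in> gelfand_ideal x"
    unfolding gelfand_ideal_def by blast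
next
  fix X A :: "'a \<Rightarrow>\<^sub>L 'a" assume X: "X \<in> gelfand_ideal x" and A: "A \<in> bounded_ops"
  obtain m C where m: "0 \<le> C" "\<And>n. gelfand_le X (m * n) (C * x n)"
    using X unfolding gelfand_ideal_def by blast
  have "gelfand_le (A o\<^sub>L X) (m * n) (norm A * C * x n)" for n
    using gelfand_le_compose_left[OF m(2)] by (simp add: mult.assoc)
  moreover have "0 \<le> norm A * C" using m by simp
  moreover have b: "X \<in> bounded_ops" using X unfolding gelfand_ideal_def by blast
  ultimately show "A o\<^sub>L X \<in> gelfand_ideal x"
    unfolding gelfand_ideal_def using bounded_ops_compose[OF A] by blast
  have "gelfand_le (X o\<^sub>L A) (m * n) (C * norm A * x n)" for n
    using gelfand_le_compose_right[OF m(2)[of n] _ A] m(1) x[of n]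
    by (simp add: mult.assoc mult.commute[of "x n"])
  moreover have "0 \<le> C * norm A" using m by simp
  ultimately show "X o\<^sub>L A \<in> gelfand_ideal x"
    unfolding gelfand_ideal_def using bounded_ops_compose[OF b A] by blast
qed

section \<open>The characteristic set of a principal ideal\<close>

lemma c0_starD:
  assumes "\<xi> \<in> c0_star"
  shows "1 \<le> n \<Longrightarrow> 0 \<le> \<xi> n" "1 \<le> m \<Longrightarrow> m \<le> n \<Longrightarrow> \<xi> n \<le> \<xi> m" "\<xi> \<longlonglongrightarrow> 0"
  using assms unfolding c0_star_def by auto

lemma diag_eq:
  "diag b \<xi> = weighted_composition (\<lambda>n. b (Suc n)) (\<lambda>n. n) (\<lambda>n. complex_of_real (\<xi> (Suc n)))"
  unfolding diag_def weighted_composition_def ..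

lemma diag_props:
  assumes b: "orthonormal_seq b" and \<xi>: "\<xi> \<in> c0_star"
  shows diag_apply:
      "blinfun_apply (diag b \<xi>) v = (\<Sum>n. (complex_of_real (\<xi> (Suc n)) * cinner (b (Suc n)) v) *\<^sub>C b (Suc n))"
    and diag_bounded_ops: "diag b \<xi> \<in> bounded_ops"
    and cinner_diag:
      "cinner (b (Suc n)) (blinfun_apply (diag b \<xi>) v) = complex_of_real (\<xi> (Suc n)) * cinner (b (Suc n)) v"
proof -
  have K: "cmod (complex_of_real (\<xi> (Suc n))) \<le> \<xi> 1" for n
    using c0_starD[OF \<xi>] by auto
  note W = weighted_composition[OF orthonormal_Suc[OF b], of "\<lambda>n. n" "\<lambda>n. complex_of_real (\<xi> (Suc n))",
      folded diag_eq, OF _ K]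
  show "blinfun_apply (diag b \<xi>) v = (\<Sum>n. (complex_of_real (\<xi> (Suc n)) * cinner (b (Suc n)) v) *\<^sub>C b (Suc n))"
    by (rule W(1)) (auto simp: inj_on_def)
  show "diag b \<xi> \<in> bounded_ops" by (rule W(2)) (auto simp: inj_on_def)
  show "cinner (b (Suc n)) (blinfun_apply (diag b \<xi>) v) = complex_of_real (\<xi> (Suc n)) * cinner (b (Suc n)) v"
    by (rule W(3)) (auto simp: inj_on_def)
qed

text \<open>On the vectors orthogonal to the first \<open>n\<close> basis vectors, only the entries from
  \<open>\<xi> (Suc n)\<close> on are felt.\<close>

lemma diag_in_gelfand_ideal:
  assumes b: "orthonormal_seq b" and \<xi>: "\<xi> \<in> c0_star"
  shows "diag b \<xi> \<in> gelfand_ideal (\<lambda>n. \<xi> (Suc n))"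
proof -
  note e = orthonormal_Suc[OF b]
  have "gelfand_le (diag b \<xi>) (1 * n) (1 * \<xi> (Suc n))" for n
    unfolding gelfand_le_def
  proof (intro exI[of _ "(\<lambda>i. cinner (b (Suc i))) ` {..<n}"] conjI allI impI)
    show "card ((\<lambda>i. cinner (b (Suc i))) ` {..<n}) \<le> 1 * n"
      using card_image_le[of "{..<n}"] by force
    show "\<forall>f\<in>(\<lambda>i. cinner (b (Suc i))) ` {..<n}. clinear_functional f"
      by (auto simp: clinear_functional_def cinner_add_right cinner_scaleC_right)
    fix v assume v: "\<forall>f\<in>(\<lambda>i. cinner (b (Suc i))) ` {..<n}. f v = 0"
    have "cmod (complex_of_real (\<xi> (Suc i)) * cinner (b (Suc i)) v)
        \<le> \<xi> (Suc n) * cmod (cinner (b (Suc i)) v)" for i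
    proof (cases "i < n")
      case True
      then show ?thesis using v by simp
    next
      case False
      then show ?thesis using c0_starD[OF \<xi>] by (auto simp: norm_mult intro!: mult_right_mono)
    qed
    then have "(\<Sum>i<N. (cmod (complex_of_real (\<xi> (Suc i)) * cinner (b (Suc i)) v))\<^sup>2)
        \<le> (\<xi> (Suc n) * norm v)\<^sup>2" for N
      using c0_starD[OF \<xi>] by (intro weighted_coeff_bound[OF e, of "\<lambda>i. i"]) auto
    then show "norm (blinfun_apply (diag b \<xi>) v) \<le> 1 * \<xi> (Suc n) * norm v"
      unfolding diag_apply[OF b \<xi>]
      using c0_starD[OF \<xi>] orthonormal_series(2)[OF e, of "\<xi> (Suc n) * norm v"] by simp
  qed auto
  then show ?thesis
    unfolding gelfand_ideal_def using diag_bounded_ops[OF b \<xi>] zero_le_one by blast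
qed

lemma principal_subset_gelfand_ideal:
  assumes "orthonormal_seq b" "\<xi> \<in> c0_star"
  shows "principal b \<xi> \<subseteq> gelfand_ideal (\<lambda>n. \<xi> (Suc n))"
  unfolding principal_def
  using diag_in_gelfand_ideal[OF assms] c0_starD[OF assms(2)]
  by (intro hull_minimal two_sided_ideal_gelfand_ideal) auto

lemma two_sided_ideal_principal:
  assumes "orthonormal_seq b" "\<xi> \<in> c0_star"
  shows "two_sided_ideal (principal b \<xi>)"
proof -
  have "principal b \<xi> \<subseteq> bounded_ops"
    using principal_subset_gelfand_ideal[OF assms] unfolding gelfand_ideal_def by blast
  then show ?thesis
    unfolding two_sided_ideal_def principal_def hull_def by blast
qed

text \<open>All Gelfand numbers of the identity are at least \<open>1\<close>, while \<open>\<xi>\<close> tends to \<open>0\<close>.\<close>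

lemma proper_ideal_principal:
  fixes b :: "nat \<Rightarrow> 'h::complex_hilbert"
  assumes b: "orthonormal_seq b" and \<xi>: "\<xi> \<in> c0_star"
  shows "proper_ideal (principal b \<xi>)"
proof -
  have "(id_blinfun :: 'h \<Rightarrow>\<^sub>L 'h) \<notin> gelfand_ideal (\<lambda>n. \<xi> (Suc n))"
  proof
    assume "id_blinfun \<in> (gelfand_ideal (\<lambda>n. \<xi> (Suc n)) :: ('h \<Rightarrow>\<^sub>L 'h) set)"
    then obtain m C where g: "\<And>n. gelfand_le (id_blinfun :: 'h \<Rightarrow>\<^sub>L 'h) (m * n) (C * \<xi> (Suc n))"
      unfolding gelfand_ideal_def by blast
    have "1 \<le> C * \<xi> (Suc n)" for n
      by (rule gelfand_le_lower[OF g orthonormal_Suc[OF b]]) simp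
    moreover have "(\<lambda>n. C * \<xi> (Suc n)) \<longlonglongrightarrow> C * 0"
      by (intro tendsto_mult tendsto_const LIMSEQ_Suc c0_starD(3)[OF \<xi>])
    ultimately have "1 \<le> C * (0 :: real)" by (intro LIMSEQ_le_const) auto
    then show False by simp
  qed
  moreover have "id_blinfun \<in> (bounded_ops :: ('h \<Rightarrow>\<^sub>L 'h) set)" unfolding bounded_ops_def by simp
  ultimately show ?thesis
    using two_sided_ideal_principal[OF assms] principal_subset_gelfand_ideal[OF assms]
    unfolding proper_ideal_def by blast
qed

text \<open>On the span of the first \<open>k + 1\<close> eigenvectors of \<open>X\<^sup>* X\<close> the operator \<open>X\<close> expands by at
  least \<open>\<sigma> (Suc k)\<close>.\<close>

lemma s_numbers_le_gelfand:
  assumes X: "X \<in> bounded_ops" and s: "s_numbers X \<sigma>" and g: "gelfand_le X k c"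
  shows "\<sigma> (Suc k) \<le> c"
proof -
  obtain e where b: "orthonormal_seq e"
    and eig: "\<And>n v. 1 \<le> n \<Longrightarrow> cinner (blinfun_apply X (e n)) (blinfun_apply X v) = complex_of_real ((\<sigma> n)\<^sup>2) * cinner (e n) v"
    using s unfolding s_numbers_def by blast
  note \<sigma> = c0_starD[of \<sigma>]
  have s0: "\<sigma> \<in> c0_star" using s unfolding s_numbers_def by blast
  note e = orthonormal_Suc[OF b]
  show ?thesis
  proof (rule gelfand_le_lower[OF g e])
    fix a :: "nat \<Rightarrow> complex"
    let ?v = "\<Sum>i\<le>k. a i *\<^sub>C e (Suc i)"
    \<comment> \<open>The eigenvalue equation diagonalises the quadratic form \<open>\<parallel>X v\<parallel>\<^sup>2\<close> on the span.\<close>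
    have Xv: "blinfun_apply X ?v = (\<Sum>i\<le>k. a i *\<^sub>C blinfun_apply X (e (Suc i)))"
      by (simp add: blinfun.sum_right bounded_ops_scaleC[OF X])
    have "complex_of_real ((norm (blinfun_apply X ?v))\<^sup>2) = cinner (blinfun_apply X ?v) (blinfun_apply X ?v)"
      by (simp add: cinner_self)
    also have "\<dots> = (\<Sum>i\<le>k. cnj (a i) * cinner (blinfun_apply X (e (Suc i))) (blinfun_apply X ?v))"
      by (subst Xv) (simp add: cinner_sum_left cinner_scaleC_left)
    also have "\<dots> = (\<Sum>i\<le>k. complex_of_real ((\<sigma> (Suc i))\<^sup>2 * (cmod (a i))\<^sup>2))"
      using cinner_orthonormal_sum[OF e, of "{..k}" _ a]
      by (intro sum.cong) (simp_all add: eig complex_norm_square mult_ac del: of_real_power)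
    finally have "(norm (blinfun_apply X ?v))\<^sup>2 = (\<Sum>i\<le>k. (\<sigma> (Suc i))\<^sup>2 * (cmod (a i))\<^sup>2)"
      unfolding of_real_sum[symmetric] using of_real_eq_iff by blast
    also have "\<dots> \<ge> (\<Sum>i\<le>k. (\<sigma> (Suc k))\<^sup>2 * (cmod (a i))\<^sup>2)"
      using \<sigma>[OF s0] by (intro sum_mono mult_right_mono power_mono) auto
    finally have "(\<sigma> (Suc k) * norm ?v)\<^sup>2 \<le> (norm (blinfun_apply X ?v))\<^sup>2"
      using norm_orthonormal_sum[OF e, of "{..k}" a]
      by (simp add: power_mult_distrib sum_distrib_left)
    then show "\<sigma> (Suc k) * norm ?v \<le> norm (blinfun_apply X ?v)"
      by (rule power2_le_imp_le) simp
  qed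
qed

text \<open>The basis itself serves as the system of eigenvectors, even if \<open>\<sigma>\<close> has zeros.\<close>

lemma s_numbers_diag:
  assumes b: "orthonormal_basis b" and \<sigma>: "\<sigma> \<in> c0_star"
  shows "s_numbers (diag b \<sigma>) \<sigma>"
proof -
  have o: "orthonormal_seq b" and t: "\<And>v. (\<forall>n\<ge>1. cinner (b n) v = 0) \<Longrightarrow> v = 0"
    using b unfolding orthonormal_basis_def by auto
  note e = orthonormal_Suc[OF o]
  have D: "blinfun_apply (diag b \<sigma>) (b (Suc n)) = complex_of_real (\<sigma> (Suc n)) *\<^sub>C b (Suc n)" for n
    by (rule total_orthonormal_eqI[OF total_orthonormal_Suc[OF b]])
       (use e in \<open>auto simp: cinner_diag[OF o \<sigma>] cinner_scaleC_right orthonormal_def\<close>)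
  have "cinner (blinfun_apply (diag b \<sigma>) (b n)) (blinfun_apply (diag b \<sigma>) v)
      = complex_of_real ((\<sigma> n)\<^sup>2) * cinner (b n) v" if n: "n \<ge> 1" for n v
  proof -
    obtain j where "n = Suc j" using n by (cases n) auto
    then show ?thesis by (simp add: D cinner_scaleC_left cinner_diag[OF o \<sigma>] power2_eq_square)
  qed
  moreover have "blinfun_apply (diag b \<sigma>) v = 0" if "\<forall>n\<ge>1. cinner (b n) v = 0" for v
    using t[OF that] by simp
  ultimately show ?thesis unfolding s_numbers_def using \<sigma> o by blast
qed

lemma ideal_sum:
  assumes "two_sided_ideal P" "\<And>j. j < (m::nat) \<Longrightarrow> g j \<in> P"
  shows "(\<Sum>j<m. g j) \<in> P"
  using assms(2) assms(1) unfolding two_sided_ideal_def by (induction m) auto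

text \<open>Split the diagonal of \<open>\<sigma>\<close> by the residue of the index modulo \<open>m\<close>. On each class, compress to
  all indices, apply \<open>diag b \<xi>\<close>, and spread out again while correcting the entries by the bounded quotients
  \<open>\<sigma>\<^sub>i / \<xi>\<^bsub>i div m\<^esub>\<close>.\<close>

lemma diag_in_principal:
  assumes b: "orthonormal_basis b" and \<xi>: "\<xi> \<in> c0_star" and \<sigma>: "\<sigma> \<in> c0_star"
    and m: "0 < m" and C: "0 \<le> C" and le: "\<And>i. \<sigma> (Suc i) \<le> C * \<xi> (Suc (i div m))"
  shows "diag b \<sigma> \<in> principal b \<xi>"
proof -
  have o: "orthonormal_seq b" using b unfolding orthonormal_basis_def by auto
  note e = orthonormal_Suc[OF o]
  define r where "r i = complex_of_real (\<sigma> (Suc i) / \<xi> (Suc (i div m)))" for i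
  \<comment> \<open>If \<open>\<xi>\<close> vanishes at the index then so does \<open>\<sigma>\<close>, and \<open>0 / 0 = 0\<close> is the right correction.\<close>
  have r: "cmod (r i) \<le> C" for i
    using le[of i] C c0_starD(1)[OF \<xi>, of "Suc (i div m)"] c0_starD(1)[OF \<sigma>, of "Suc i"]
    by (cases "\<xi> (Suc (i div m)) = 0") (auto simp: r_def norm_divide divide_simps)
  have r\<xi>: "r i * complex_of_real (\<xi> (Suc (i div m))) = complex_of_real (\<sigma> (Suc i))" for i
    using le[of i] c0_starD(1)[OF \<sigma>, of "Suc i"]
    by (cases "\<xi> (Suc (i div m)) = 0") (auto simp: r_def)
  define L where "L j = weighted_composition (\<lambda>n. b (Suc n)) (\<lambda>n. n div m) (\<lambda>n. if n mod m = j then r n else 0)" for j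
  define R where "R j = weighted_composition (\<lambda>n. b (Suc n)) (\<lambda>n. m * n + j) (\<lambda>n. 1)" for j
  have injL: "inj_on (\<lambda>n. n div m) {n. (if n mod m = j then r n else 0) \<noteq> 0}" for j
    unfolding inj_on_def by (auto split: if_splits) (metis div_mult_mod_eq)
  have KL: "cmod (if n mod m = j then r n else 0) \<le> C" for n j using r C by auto
  have injR: "inj_on (\<lambda>n. m * n + j) {n. (1 :: complex) \<noteq> 0}" for j
    using m by (auto simp: inj_on_def)
  have KR: "cmod 1 \<le> 1" by simp
  note L = weighted_composition_bounded_ops[OF e injL KL, folded L_def]
    cinner_weighted_composition[OF e injL KL, folded L_def]
  note R = weighted_composition_bounded_ops[OF e injR KR, folded R_def]
    cinner_weighted_composition[OF e injR KR, folded R_def]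
  have "diag b \<sigma> = (\<Sum>j<m. L j o\<^sub>L diag b \<xi> o\<^sub>L R j)"
  proof (rule blinfun_eqI, rule total_orthonormal_eqI[OF total_orthonormal_Suc[OF b]])
    fix v n
    have "cinner (b (Suc n)) (blinfun_apply (\<Sum>j<m. L j o\<^sub>L diag b \<xi> o\<^sub>L R j) v)
        = (\<Sum>j<m. cinner (b (Suc n)) (blinfun_apply (L j) (blinfun_apply (diag b \<xi>) (blinfun_apply (R j) v))))"
      by (simp add: blinfun.sum_left cinner_sum_right)
    also have "\<dots> = (\<Sum>j<m. if j = n mod m then complex_of_real (\<sigma> (Suc n)) * cinner (b (Suc n)) v else 0)"
      by (intro sum.cong) (auto simp: L(2) R(2) cinner_diag[OF o \<xi>] r\<xi> simp flip: mult.assoc)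
    also have "\<dots> = complex_of_real (\<sigma> (Suc n)) * cinner (b (Suc n)) v"
      using m by simp
    finally show "cinner (b (Suc n)) (blinfun_apply (diag b \<sigma>) v)
        = cinner (b (Suc n)) (blinfun_apply (\<Sum>j<m. L j o\<^sub>L diag b \<xi> o\<^sub>L R j) v)"
      by (simp add: cinner_diag[OF o \<sigma>])
  qed
  also have "\<dots> \<in> principal b \<xi>"
  proof (rule ideal_sum[OF two_sided_ideal_principal[OF o \<xi>]])
    have P: "two_sided_ideal (principal b \<xi>)" by (rule two_sided_ideal_principal[OF o \<xi>])
    have "diag b \<xi> \<in> principal b \<xi>" unfolding principal_def by (rule hull_inc) simp
    then show "L j o\<^sub>L diag b \<xi> o\<^sub>L R j \<in> principal b \<xi>" for j
      using P L(1) R(1) unfolding two_sided_ideal_def by blast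
  qed
  finally show ?thesis .
qed

text \<open>For nonincreasing sequences with \<open>\<xi> 1 > 0\<close> this says \<open>\<sigma> = O(D\<^sub>l \<xi>)\<close> for some \<open>l\<close>. Sampling at the
  multiples of \<open>m\<close> instead of repeating the entries of \<open>\<xi>\<close> avoids rounding in the estimates.\<close>

definition dominated :: "(nat \<Rightarrow> real) \<Rightarrow> (nat \<Rightarrow> real) \<Rightarrow> bool" where
  "dominated \<sigma> \<xi> \<longleftrightarrow> (\<exists>m\<ge>1. \<exists>C>0. \<forall>n\<ge>1. \<sigma> (m * n) \<le> C * \<xi> n)"

text \<open>Upper bound: the Gelfand ideal. Lower bound: diagonal operators. The hypothesis \<open>\<xi> 1 > 0\<close>
  pays for the entries \<open>\<sigma> i\<close> with \<open>i < m\<close>, about which \<open>dominated\<close> says nothing.\<close>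

lemma char_set_principal:
  fixes b :: "nat \<Rightarrow> 'h::complex_hilbert"
  assumes b: "orthonormal_basis b" and \<xi>: "\<xi> \<in> c0_star" and pos: "\<xi> 1 > 0"
  shows "char_set (principal b \<xi>) = {\<sigma> \<in> c0_star. dominated \<sigma> \<xi>}"
proof (intro equalityI subsetI)
  have o: "orthonormal_seq b" using b unfolding orthonormal_basis_def by auto
  fix \<sigma> assume "\<sigma> \<in> char_set (principal b \<xi>)"
  then obtain X :: "'h \<Rightarrow>\<^sub>L 'h" where X: "X \<in> gelfand_ideal (\<lambda>n. \<xi> (Suc n))" and s: "s_numbers X \<sigma>"
    using principal_subset_gelfand_ideal[OF o \<xi>] unfolding char_set_def by blast
  have \<sigma>: "\<sigma> \<in> c0_star" using s unfolding s_numbers_def by blast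
  obtain m C where C: "0 \<le> C" and g: "\<And>n. gelfand_le X (m * n) (C * \<xi> (Suc n))"
    and Xb: "X \<in> bounded_ops"
    using X unfolding gelfand_ideal_def by blast
  have "\<sigma> (Suc m * n) \<le> (C + 1) * \<xi> n" if n: "n \<ge> 1" for n
  proof -
    obtain i where i: "n = Suc i" using n by (cases n) auto
    have "\<sigma> (Suc m * n) \<le> \<sigma> (Suc (m * i))" using i by (intro c0_starD(2)[OF \<sigma>]) auto
    also have "\<dots> \<le> C * \<xi> n" using s_numbers_le_gelfand[OF Xb s g] i by simp
    also have "\<dots> \<le> (C + 1) * \<xi> n" using c0_starD(1)[OF \<xi> n] by (simp add: distrib_right)
    finally show ?thesis .
  qed
  then have "dominated \<sigma> \<xi>" unfolding dominated_def using C
    by (intro exI[of _ "Suc m"] conjI exI[of _ "C + 1"]) auto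
  then show "\<sigma> \<in> {\<sigma> \<in> c0_star. dominated \<sigma> \<xi>}" using \<sigma> by blast
next
  fix \<sigma> assume "\<sigma> \<in> {\<sigma> \<in> c0_star. dominated \<sigma> \<xi>}"
  then obtain m C where \<sigma>: "\<sigma> \<in> c0_star" and m: "m \<ge> 1" and C: "C > 0"
    and dom: "\<And>n. n \<ge> 1 \<Longrightarrow> \<sigma> (m * n) \<le> C * \<xi> n"
    unfolding dominated_def by blast
  define C' where "C' = C + \<sigma> 1 / \<xi> 1"
  have q: "0 \<le> \<sigma> 1 / \<xi> 1" using pos c0_starD(1)[OF \<sigma>] by simp
  \<comment> \<open>Passing from \<open>m\<close> to \<open>2 * m\<close> absorbs the shift between \<open>Suc (i div m)\<close> and \<open>Suc i div m\<close>.\<close>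
  have "\<sigma> (Suc i) \<le> C' * \<xi> (Suc (i div (2 * m)))" for i
  proof (cases "Suc i < m")
    case True
    then have "\<sigma> (Suc i) \<le> \<sigma> 1 / \<xi> 1 * \<xi> (Suc (i div (2 * m)))"
      using c0_starD(2)[OF \<sigma>, of 1 "Suc i"] pos by simp
    also have "\<dots> \<le> C' * \<xi> (Suc (i div (2 * m)))"
      unfolding C'_def using C c0_starD(1)[OF \<xi>] by (intro mult_right_mono) auto
    finally show ?thesis .
  next
    case False
    define n where "n = Suc i div m"
    have n: "n \<ge> 1" using False m by (simp add: n_def div_greater_zero_iff Suc_le_eq)
    have "i < 2 * m * n"
    proof -
      have "Suc i < m * n + m"
        using mod_less_divisor[of m "Suc i"] mult_div_mod_eq[of m "Suc i"] m unfolding n_def by linarith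
      moreover have "m \<le> m * n" using n by simp
      ultimately show ?thesis by linarith
    qed
    then have k: "Suc (i div (2 * m)) \<le> n"
      using m by (simp add: Suc_le_eq less_mult_imp_div_less mult_ac)
    have "\<sigma> (Suc i) \<le> \<sigma> (m * n)"
      using n m by (intro c0_starD(2)[OF \<sigma>]) (auto simp: n_def)
    also have "\<dots> \<le> C * \<xi> n" by (rule dom[OF n])
    also have "\<dots> \<le> C' * \<xi> (Suc (i div (2 * m)))"
      using C q k c0_starD[OF \<xi>] n by (intro mult_mono) (auto simp: C'_def)
    finally show ?thesis .
  qed
  then have "diag b \<sigma> \<in> principal b \<xi>"
    using m C q by (intro diag_in_principal[OF b \<xi> \<sigma>, of "2 * m" C']) (auto simp: C'_def)
  then show "\<sigma> \<in> char_set (principal b \<xi>)"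
    using s_numbers_diag[OF b \<sigma>] unfolding char_set_def by blast
qed

section \<open>Tails and arithmetic means at infinity\<close>

definition tail :: "(nat \<Rightarrow> real) \<Rightarrow> nat \<Rightarrow> real" where
  "tail \<xi> n = (\<Sum>j. \<xi> (j + Suc n))"

lemma am_inf_eq: "am_inf \<xi> n = tail \<xi> n / real n"
  by (simp add: am_inf_def tail_def)

lemma l1_starD:
  assumes "\<xi> \<in> l1_star"
  shows "\<xi> \<in> c0_star" "summable \<xi>"
  using assms unfolding l1_star_def by auto

lemma summable_tail:
  assumes "\<xi> \<in> l1_star"
  shows "summable (\<lambda>j. \<xi> (j + n))"
  using l1_starD(2)[OF assms] by (rule summable_ignore_initial_segment)

lemma tail_nonneg: "\<xi> \<in> l1_star \<Longrightarrow> 0 \<le> tail \<xi> n"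
  unfolding tail_def by (intro suminf_nonneg summable_tail c0_starD(1) l1_starD) auto

lemma tail_split:
  assumes "\<xi> \<in> l1_star"
  shows "tail \<xi> n = tail \<xi> (n + d) + (\<Sum>j<d. \<xi> (j + Suc n))"
  using suminf_split_initial_segment[OF summable_tail[OF assms, of "Suc n"], of d]
  unfolding tail_def by (simp add: add_ac)

text \<open>The \<open>d\<close> terms between the two tails lie between \<open>\<xi> (n + d)\<close> and \<open>\<xi> n\<close>.\<close>

lemma tail_split_bounds:
  assumes \<xi>: "\<xi> \<in> l1_star"
  shows tail_split_le: "1 \<le> n \<Longrightarrow> tail \<xi> n \<le> tail \<xi> (n + d) + real d * \<xi> n"
    and tail_split_ge: "tail \<xi> (n + d) + real d * \<xi> (n + d) \<le> tail \<xi> n"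
proof -
  note mono = c0_starD(2)[OF l1_starD(1)[OF \<xi>]]
  have "(\<Sum>j<d. \<xi> (j + Suc n)) \<le> real d * \<xi> n" if "1 \<le> n"
    using sum_bounded_above[of "{..<d}" "\<lambda>j. \<xi> (j + Suc n)" "\<xi> n"] that mono[of n] by auto
  then show "1 \<le> n \<Longrightarrow> tail \<xi> n \<le> tail \<xi> (n + d) + real d * \<xi> n"
    using tail_split[OF \<xi>, of n d] by simp
  have "real d * \<xi> (n + d) \<le> (\<Sum>j<d. \<xi> (j + Suc n))"
    using sum_bounded_below[of "{..<d}" "\<xi> (n + d)" "\<lambda>j. \<xi> (j + Suc n)"] mono by auto
  then show "tail \<xi> (n + d) + real d * \<xi> (n + d) \<le> tail \<xi> n"
    using tail_split[OF \<xi>, of n d] by simp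
qed

lemma tail_antimono:
  assumes \<xi>: "\<xi> \<in> l1_star" and "m \<le> n"
  shows "tail \<xi> n \<le> tail \<xi> m"
proof (cases "n = m")
  case False
  then show ?thesis
    using tail_split_ge[OF \<xi>, of m "n - m"] c0_starD(1)[OF l1_starD(1)[OF \<xi>], of n] \<open>m \<le> n\<close>
    by (smt (verit) le_add_diff_inverse less_one linorder_not_le mult_nonneg_nonneg of_nat_0_le_iff le_zero_eq)
qed simp

lemma am_inf_nonneg: "\<xi> \<in> l1_star \<Longrightarrow> 0 \<le> am_inf \<xi> n"
  unfolding am_inf_eq using tail_nonneg by simp

lemma am_inf_antimono:
  assumes "\<xi> \<in> l1_star" "1 \<le> m" "m \<le> n"
  shows "am_inf \<xi> n \<le> am_inf \<xi> m"
  unfolding am_inf_eq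
  using assms tail_antimono tail_nonneg by (intro frac_le) auto

lemma am_inf_c0_star:
  assumes \<xi>: "\<xi> \<in> l1_star"
  shows "am_inf \<xi> \<in> c0_star"
proof -
  have "(\<lambda>n. tail \<xi> 0 / real n) \<longlonglongrightarrow> 0" by (rule lim_const_over_n)
  then have "am_inf \<xi> \<longlonglongrightarrow> 0"
    by (rule real_tendsto_sandwich[OF _ _ tendsto_const, rotated 2])
       (use am_inf_nonneg[OF \<xi>] tail_antimono[OF \<xi>, of 0]
         in \<open>auto simp: am_inf_eq intro!: always_eventually divide_right_mono\<close>)
  then show ?thesis
    unfolding c0_star_def using am_inf_nonneg[OF \<xi>] am_inf_antimono[OF \<xi>] by auto
qed

text \<open>The \<open>n\<close> terms \<open>\<xi>\<^bsub>n+1\<^esub>, \<dots>, \<xi>\<^bsub>2n\<^esub>\<close> of the tail are all at least \<open>\<xi>\<^bsub>2n\<^esub>\<close>.\<close>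

lemma double_le_am_inf:
  assumes \<xi>: "\<xi> \<in> l1_star" and n: "1 \<le> n"
  shows "\<xi> (2 * n) \<le> am_inf \<xi> n"
  using tail_split_ge[OF \<xi>, of n n] tail_nonneg[OF \<xi>, of "n + n"] n
  by (simp add: am_inf_eq le_divide_eq mult.commute[of _ "real n"] mult_2)

section \<open>Bounded tails and geometric decay of tails\<close>

text \<open>The non-asymptotic form of \<open>am_inf \<xi> \<in> O(\<xi>)\<close>, to which every condition of the theorem is reduced.\<close>

definition tail_bounded :: "(nat \<Rightarrow> real) \<Rightarrow> bool" where
  "tail_bounded \<xi> \<longleftrightarrow> (\<exists>C>0. \<forall>n\<ge>1. am_inf \<xi> n \<le> C * \<xi> n)"

text \<open>Since \<open>am_inf \<xi> n / am_inf \<xi> (k * n)\<close> is \<open>k\<close> times the quotient of the tails at \<open>n\<close> and \<open>k * n\<close>, this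
  is what it means for the infimum of these quotients to exceed \<open>k\<close>.\<close>

definition tail_decay :: "(nat \<Rightarrow> real) \<Rightarrow> nat \<Rightarrow> bool" where
  "tail_decay \<xi> k \<longleftrightarrow> (\<exists>q. 0 < q \<and> q < 1 \<and> (\<forall>n\<ge>1. tail \<xi> (k * n) \<le> q * tail \<xi> n))"

text \<open>The finitely many exceptional indices can be absorbed into the constant: where \<open>\<xi>\<close> vanishes,
  so does the whole tail.\<close>

lemma bigo_iff_tail_bounded:
  assumes \<xi>: "\<xi> \<in> l1_star"
  shows "am_inf \<xi> \<in> O(\<xi>) \<longleftrightarrow> tail_bounded \<xi>"
proof
  note pos = c0_starD(1)[OF l1_starD(1)[OF \<xi>]] and mono = c0_starD(2)[OF l1_starD(1)[OF \<xi>]]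
  note ab = am_inf_nonneg[OF \<xi>]
  assume "tail_bounded \<xi>"
  then obtain C where "\<And>n. n \<ge> 1 \<Longrightarrow> am_inf \<xi> n \<le> C * \<xi> n"
    unfolding tail_bounded_def by blast
  then have "eventually (\<lambda>n. norm (am_inf \<xi> n) \<le> C * norm (\<xi> n)) sequentially"
    using pos ab by (intro eventually_sequentiallyI[of 1]) auto
  then show "am_inf \<xi> \<in> O(\<xi>)" by (rule bigoI)
next
  note pos = c0_starD(1)[OF l1_starD(1)[OF \<xi>]] and mono = c0_starD(2)[OF l1_starD(1)[OF \<xi>]]
  assume "am_inf \<xi> \<in> O(\<xi>)"
  then obtain c N where c: "c > 0" and N: "\<And>n. n \<ge> N \<Longrightarrow> norm (am_inf \<xi> n) \<le> c * norm (\<xi> n)"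
    unfolding bigo_def eventually_sequentially by auto
  \<comment> \<open>Division by zero makes the summands with \<open>n = 0\<close> or \<open>\<xi> n = 0\<close> vanish.\<close>
  define D where "D = (\<Sum>n<N. am_inf \<xi> n / \<xi> n)"
  have quo: "0 \<le> am_inf \<xi> n / \<xi> n" for n
    using am_inf_nonneg[OF \<xi>, of n] pos[of n]
    by (cases "n = 0") (simp add: am_inf_eq, intro divide_nonneg_nonneg, auto)
  have "am_inf \<xi> n \<le> (c + D) * \<xi> n" if n: "n \<ge> 1" for n
  proof (cases "n \<ge> N \<or> \<xi> n = 0")
    case True
    have "am_inf \<xi> n \<le> c * \<xi> n"
    proof (cases "n \<ge> N")
      case True
      then show ?thesis using N[OF True] pos[OF n] by simp
    next
      case False
      then have z: "\<xi> n = 0" using \<open>n \<ge> N \<or> \<xi> n = 0\<close> by blast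
      have "\<xi> (j + Suc n) = 0" for j
        using mono[OF n, of "j + Suc n"] pos[of "j + Suc n"] z by simp
      then show ?thesis using z by (simp add: am_inf_def del: add_Suc_right)
    qed
    also have "\<dots> \<le> (c + D) * \<xi> n"
      using quo pos[OF n] unfolding D_def by (intro mult_right_mono) (auto simp: sum_nonneg)
    finally show ?thesis .
  next
    case False
    then have "am_inf \<xi> n / \<xi> n \<le> D"
      unfolding D_def using quo by (intro member_le_sum) auto
    then have "am_inf \<xi> n / \<xi> n \<le> c + D" using c by simp
    then show ?thesis using False pos[OF n] by (simp add: divide_le_eq)
  qed
  moreover have "c + D > 0" unfolding D_def using c quo by (simp add: add_pos_nonneg sum_nonneg)
  ultimately show "tail_bounded \<xi>" unfolding tail_bounded_def by blast
qed

text \<open>If the tail at \<open>k n\<close> is at most \<open>C k n \<xi>\<^bsub>kn\<^esub>\<close>, then it is comparable to the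
  \<open>(k - 1) n\<close> terms just before it, so a fixed fraction of the tail at \<open>n\<close> is lost on the way to \<open>k n\<close>.\<close>

lemma tail_decay_of_tail_bounded:
  assumes \<xi>: "\<xi> \<in> l1_star" and b: "tail_bounded \<xi>" and k: "1 < k"
  shows "tail_decay \<xi> k"
proof -
  obtain C where C: "C > 0" and bd: "\<And>n. n \<ge> 1 \<Longrightarrow> am_inf \<xi> n \<le> C * \<xi> n"
    using b unfolding tail_bounded_def by blast
  define \<delta> where "\<delta> = real (k - 1) / (C * real k)"
  have \<delta>: "\<delta> > 0" unfolding \<delta>_def using C k by simp
  have "tail \<xi> (k * n) \<le> (1 / (1 + \<delta>)) * tail \<xi> n" if n: "n \<ge> 1" for n
  proof -
    have kn: "k * n = n + (k - 1) * n" using k by (simp add: algebra_simps diff_mult_distrib)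
    have "tail \<xi> (k * n) \<le> C * (real k * real n) * \<xi> (k * n)"
      using bd[of "k * n"] n k by (simp add: am_inf_eq divide_le_eq mult_ac)
    then have "\<delta> * tail \<xi> (k * n) \<le> \<delta> * (C * (real k * real n) * \<xi> (k * n))"
      using \<delta> by simp
    also have "\<dots> = real ((k - 1) * n) * \<xi> (k * n)"
      unfolding \<delta>_def using C k by simp
    also have "\<dots> \<le> tail \<xi> n - tail \<xi> (k * n)"
      using tail_split_ge[OF \<xi>, of n "(k - 1) * n"] unfolding kn by simp
    finally show ?thesis using \<delta> by (simp add: field_simps)
  qed
  then show ?thesis
    unfolding tail_decay_def using \<delta> by (intro exI[of _ "1 / (1 + \<delta>)"]) auto
qed

text \<open>A fixed fraction of the tail at \<open>n\<close> is carried by the next \<open>(k - 1) n\<close> terms, each at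
  most \<open>\<xi>\<^sub>n\<close>.\<close>

lemma tail_bounded_of_tail_decay:
  assumes \<xi>: "\<xi> \<in> l1_star" and d: "tail_decay \<xi> k" and k: "1 \<le> k"
  shows "tail_bounded \<xi>"
proof -
  obtain q where q: "q < 1" and bd: "\<And>n. n \<ge> 1 \<Longrightarrow> tail \<xi> (k * n) \<le> q * tail \<xi> n"
    using d unfolding tail_decay_def by blast
  have "am_inf \<xi> n \<le> real k / (1 - q) * \<xi> n" if n: "n \<ge> 1" for n
  proof -
    have kn: "k * n = n + (k - 1) * n" using k by (simp add: algebra_simps diff_mult_distrib)
    have "tail \<xi> n \<le> tail \<xi> (k * n) + real ((k - 1) * n) * \<xi> n"
      using tail_split_le[OF \<xi> n, of "(k - 1) * n"] unfolding kn by simp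
    also have "\<dots> \<le> q * tail \<xi> n + real (k * n) * \<xi> n"
    proof (intro add_mono mult_right_mono)
      show "real ((k - 1) * n) \<le> real (k * n)" unfolding of_nat_le_iff by simp
    qed (use bd[OF n] c0_starD(1)[OF l1_starD(1)[OF \<xi>] n] in auto)
    finally have "(1 - q) * tail \<xi> n \<le> real (k * n) * \<xi> n" by (simp add: algebra_simps)
    then show ?thesis using q n by (simp add: am_inf_eq field_simps)
  qed
  then show ?thesis
    unfolding tail_bounded_def using q k by (intro exI[of _ "real k / (1 - q)"]) auto
qed

text \<open>The bound at \<open>2 n\<close> compares the tail at \<open>2 k n\<close> with \<open>n \<xi>\<^bsub>2n\<^esub>\<close>, hence with the terms
  between \<open>n\<close> and \<open>2 n\<close>, which are missing from that tail. This is why the dilation doubles.\<close>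

lemma tail_decay_of_dilated_bound:
  assumes \<xi>: "\<xi> \<in> l1_star" and k: "1 \<le> k" and C: "C > 0"
    and bd: "\<And>n. n \<ge> 1 \<Longrightarrow> am_inf \<xi> (k * n) \<le> C * \<xi> n"
  shows "tail_decay \<xi> (2 * k)"
proof -
  define A where "A = 2 * C * real k"
  have A: "A > 0" unfolding A_def using C k by simp
  have "tail \<xi> (2 * k * n) \<le> A / (1 + A) * tail \<xi> n" if n: "n \<ge> 1" for n
  proof -
    have "tail \<xi> (2 * k * n) \<le> A * (real n * \<xi> (2 * n))"
      using bd[of "2 * n"] n k by (simp add: am_inf_eq divide_le_eq A_def mult_ac)
    also have "\<dots> \<le> A * (tail \<xi> n - tail \<xi> (2 * k * n))"
    proof -
      have "real n * \<xi> (2 * n) \<le> tail \<xi> n - tail \<xi> (2 * n)"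
        using tail_split_ge[OF \<xi>, of n n] by (simp add: mult_2)
      moreover have "tail \<xi> (2 * k * n) \<le> tail \<xi> (2 * n)"
        using k by (intro tail_antimono[OF \<xi>]) auto
      ultimately show ?thesis using A by simp
    qed
    finally show ?thesis using A by (simp add: field_simps)
  qed
  then show ?thesis
    unfolding tail_decay_def using A by (intro exI[of _ "A / (1 + A)"]) auto
qed

lemma iterate_decay:
  fixes f :: "nat \<Rightarrow> real"
  assumes "0 \<le> q" "1 \<le> k" "\<And>n. n \<ge> 1 \<Longrightarrow> f (k * n) \<le> q * f n" "n \<ge> 1"
  shows "f (k ^ j * n) \<le> q ^ j * f n"
proof (induction j)
  case (Suc j)
  have "f (k ^ Suc j * n) \<le> q * f (k ^ j * n)"
    using assms(3)[of "k ^ j * n"] assms(2,4) by (simp add: mult.assoc Suc_le_eq)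
  also have "\<dots> \<le> q * (q ^ j * f n)" using Suc assms(1) by (rule mult_left_mono)
  finally show ?case by (simp add: mult_ac)
qed simp

lemma sums_stretch:
  fixes x :: "nat \<Rightarrow> real"
  assumes x: "\<And>i. 0 \<le> x i" and s: "summable x" and m: "0 < m"
  shows "summable (\<lambda>j. x (j div m))" "(\<Sum>j. x (j div m)) = real m * suminf x"
proof -
  have block: "(\<Sum>j\<in>{i * m..<i * m + m}. x (j div m)) = real m * x i" for i
  proof -
    have "(\<Sum>j\<in>{i * m..<i * m + m}. x (j div m)) = (\<Sum>j\<in>{i * m..<i * m + m}. x i)"
      by (intro sum.cong arg_cong[of _ _ x]) (auto intro!: div_nat_eqI simp: algebra_simps)
    then show ?thesis by simp
  qed
  show sm: "summable (\<lambda>j. x (j div m))"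
  proof (rule summableI_nonneg_bounded)
    fix N
    have "(\<Sum>j<N. x (j div m)) \<le> (\<Sum>j<N * m. x (j div m))"
      using x m by (intro sum_mono2) auto
    also have "\<dots> = (\<Sum>i<N. real m * x i)"
      unfolding sum.nat_group[symmetric] block ..
    also have "\<dots> \<le> real m * suminf x"
      unfolding sum_distrib_left[symmetric] using x by (intro mult_left_mono sum_le_suminf[OF s]) auto
    finally show "(\<Sum>j<N. x (j div m)) \<le> real m * suminf x" .
  qed (use x in auto)
  have "(\<lambda>i. real m * x i) sums (\<Sum>j. x (j div m))"
    using sums_group[OF summable_sums[OF sm] m] unfolding block .
  moreover have "(\<lambda>i. real m * x i) sums (real m * suminf x)"
    by (intro sums_mult summable_sums s)
  ultimately show "(\<Sum>j. x (j div m)) = real m * suminf x" by (rule sums_unique2)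
qed

text \<open>Cut the tail of \<open>\<eta>\<close> into blocks of length \<open>m\<close>; a term of \<open>\<eta>\<close> is at most the value of \<open>\<eta>\<close> at the last
  multiple of \<open>m\<close> before it. The extra \<open>\<xi> n\<close> comes from the block starting at \<open>m * n\<close>.\<close>

lemma tail_dilated:
  assumes \<eta>: "\<eta> \<in> c0_star" and \<xi>: "\<xi> \<in> l1_star" and m: "1 \<le> m" and C: "0 \<le> C"
    and dom: "\<And>n. n \<ge> 1 \<Longrightarrow> \<eta> (m * n) \<le> C * \<xi> n"
  shows "\<eta> \<in> l1_star"
    and "n \<ge> 1 \<Longrightarrow> tail \<eta> (m * n) \<le> C * real m * (\<xi> n + tail \<xi> n)"
proof -
  have pt: "\<eta> (j + Suc (m * n)) \<le> C * \<xi> (j div m + n)" if "n \<ge> 1" for j n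
  proof -
    have "\<eta> (j + Suc (m * n)) \<le> \<eta> (m * (j div m + n))"
    proof (rule c0_starD(2)[OF \<eta>])
      have "1 \<le> m * n" using that m by (simp add: Suc_le_eq)
      then show "1 \<le> m * (j div m + n)" unfolding distrib_left by linarith
      show "m * (j div m + n) \<le> j + Suc (m * n)" by (simp add: distrib_left le_SucI)
    qed
    then show ?thesis using dom[of "j div m + n"] that by simp
  qed
  have str: "summable (\<lambda>j. \<xi> (j div m + n))" "(\<Sum>j. \<xi> (j div m + n)) = real m * (\<Sum>i. \<xi> (i + n))"
    if "n \<ge> 1" for n
    using sums_stretch[of "\<lambda>i. \<xi> (i + n)" m] summable_tail[OF \<xi>, of n] that m
      c0_starD(1)[OF l1_starD(1)[OF \<xi>]] by auto
  have sm: "summable (\<lambda>j. \<eta> (j + Suc (m * n)))" if "n \<ge> 1" for n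
    by (rule summable_comparison_test'[OF summable_mult[OF str(1)[OF that], of C], where N = 0])
       (use pt[OF that] c0_starD(1)[OF \<eta>] in auto)
  have "summable \<eta>"
    using sm[OF order_refl] summable_iff_shift[of \<eta> "Suc (m * 1)"] by blast
  then show "\<eta> \<in> l1_star" using \<eta> unfolding l1_star_def by simp
  assume n: "n \<ge> 1"
  have "tail \<eta> (m * n) \<le> (\<Sum>j. C * \<xi> (j div m + n))"
    unfolding tail_def by (intro suminf_le pt sm summable_mult str n)
  also have "\<dots> = C * real m * (\<Sum>i. \<xi> (i + n))"
    unfolding suminf_mult[OF str(1)[OF n]] str(2)[OF n] by simp
  also have "(\<Sum>i. \<xi> (i + n)) = \<xi> n + tail \<xi> n"
    using suminf_split_head[OF summable_tail[OF \<xi>, of n]] unfolding tail_def by simp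
  finally show "tail \<eta> (m * n) \<le> C * real m * (\<xi> n + tail \<xi> n)" .
qed

section \<open>Power decay and the Matuszewska index\<close>

definition power_decay :: "(nat \<Rightarrow> real) \<Rightarrow> bool" where
  "power_decay \<xi> \<longleftrightarrow> (\<exists>C::real. \<exists>p::real. C > 0 \<and> p > 1 \<and>
     (\<forall>m\<ge>1. \<forall>n\<ge>m. \<xi> n \<le> C * (real m / real n) powr p * \<xi> m))"

text \<open>Because \<open>p > 1\<close>, a large dilation \<open>k\<close> makes \<open>\<xi>\<^bsub>kn\<^esub> \<le> \<xi>\<^sub>n / (2k)\<close>. Summing over blocks of
  length \<open>k\<close>, the tail at \<open>k n\<close> is at most half the tail at \<open>n\<close> plus \<open>\<xi>\<^sub>n / 2\<close>; the other half of the tail must lie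
  in the terms between \<open>n\<close> and \<open>k n\<close>.\<close>

lemma tail_bounded_of_power_decay:
  assumes \<xi>: "\<xi> \<in> l1_star" and d: "power_decay \<xi>"
  shows "tail_bounded \<xi>"
proof -
  obtain C p where C: "C > 0" and p: "p > 1"
    and bd: "\<And>m n. m \<ge> 1 \<Longrightarrow> n \<ge> m \<Longrightarrow> \<xi> n \<le> C * (real m / real n) powr p * \<xi> m"
    using d unfolding power_decay_def by blast
  note pos = c0_starD(1)[OF l1_starD(1)[OF \<xi>]]
  \<comment> \<open>Large enough for \<open>2 C k \<le> k\<^sup>p\<close>.\<close>
  define k where "k = nat \<lceil>(2 * C) powr (1 / (p - 1))\<rceil> + 1"
  have k: "k \<ge> 1" unfolding k_def by simp
  have "(2 * C) powr (1 / (p - 1)) \<le> real k" unfolding k_def by linarith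
  then have "((2 * C) powr (1 / (p - 1))) powr (p - 1) \<le> real k powr (p - 1)"
    using p by (intro powr_mono2) auto
  then have "2 * C \<le> real k powr (p - 1)" using p C by (simp add: powr_powr)
  then have kp: "2 * C * real k \<le> real k powr p"
    using k by (simp add: powr_diff field_simps)
  have small: "\<xi> (k * n) \<le> 1 / (2 * real k) * \<xi> n" if n: "n \<ge> 1" for n
  proof -
    have "\<xi> (k * n) \<le> C * (real n / real (k * n)) powr p * \<xi> n"
      using n k by (intro bd) auto
    also have "real n / real (k * n) = 1 / real k" using n by simp
    also have "C * (1 / real k) powr p \<le> 1 / (2 * real k)"
      using kp k by (simp add: powr_divide field_simps)
    finally show ?thesis using pos[OF n] by (simp add: mult_right_mono)
  qed
  have "am_inf \<xi> n \<le> (2 * real k) * \<xi> n" if n: "n \<ge> 1" for n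
  proof -
    have kn: "k * n = n + (k - 1) * n" using k by (simp add: algebra_simps diff_mult_distrib)
    have "tail \<xi> n \<le> tail \<xi> (k * n) + real ((k - 1) * n) * \<xi> n"
      using tail_split_le[OF \<xi> n, of "(k - 1) * n"] unfolding kn by simp
    moreover have "tail \<xi> (k * n) \<le> 1 / (2 * real k) * real k * (\<xi> n + tail \<xi> n)"
      using small k by (intro tail_dilated(2)[OF l1_starD(1)[OF \<xi>] \<xi> k _ _ n]) auto
    ultimately have "tail \<xi> n \<le> \<xi> n + 2 * real ((k - 1) * n) * \<xi> n" using k by simp
    also have "\<dots> = (1 + 2 * real ((k - 1) * n)) * \<xi> n" by (simp add: algebra_simps)
    also have "\<dots> \<le> (2 * real (k * n)) * \<xi> n"
    proof (rule mult_right_mono[OF _ pos[OF n]])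
      have "1 + 2 * ((k - 1) * n) \<le> 2 * (k * n)" using n unfolding kn by simp
      then show "1 + 2 * real ((k - 1) * n) \<le> 2 * real (k * n)" by linarith
    qed
    finally show ?thesis using n by (simp add: am_inf_eq field_simps)
  qed
  then show ?thesis unfolding tail_bounded_def using k by (intro exI[of _ "2 * real k"]) auto
qed

text \<open>Tails decay geometrically along \<open>2\<^sup>j m\<close>, with ratio \<open>q < 1\<close>; dividing by the index, \<open>\<xi>\<close>
  itself decays with ratio \<open>q / 2 = 2\<^bsup>-p\<^esup>\<close>, and \<open>q < 1\<close> means \<open>p > 1\<close>. Monotonicity interpolates between
  consecutive powers of \<open>2\<close> at the cost of a factor \<open>2\<^sup>p\<close>.\<close>

lemma power_decay_of_tail_bounded:
  assumes \<xi>: "\<xi> \<in> l1_star" and b: "tail_bounded \<xi>"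
  shows "power_decay \<xi>"
proof -
  note pos = c0_starD(1)[OF l1_starD(1)[OF \<xi>]] and mono = c0_starD(2)[OF l1_starD(1)[OF \<xi>]]
  obtain C where C: "C > 0" and bd: "\<And>n. n \<ge> 1 \<Longrightarrow> am_inf \<xi> n \<le> C * \<xi> n"
    using b unfolding tail_bounded_def by blast
  obtain q where q: "0 < q" "q < 1" and dec: "\<And>n. n \<ge> 1 \<Longrightarrow> tail \<xi> (2 * n) \<le> q * tail \<xi> n"
    using tail_decay_of_tail_bounded[OF \<xi> b, of 2] unfolding tail_decay_def by auto
  \<comment> \<open>The summand \<open>1\<close> covers \<open>j = 0\<close>; for \<open>j > 0\<close>, one dyadic step is lost in passing from tails to terms.\<close>
  define C' where "C' = 1 + 2 * C / q"
  have C': "C' > 0" unfolding C'_def using C q by (simp add: add_pos_pos)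
  have dyadic: "\<xi> (2 ^ j * m) \<le> C' * (q / 2) ^ j * \<xi> m" if m: "m \<ge> 1" for j m
  proof (cases j)
    case 0
    then show ?thesis using C q pos[OF m] by (simp add: C'_def distrib_right)
  next
    case (Suc i)
    have "\<xi> (2 ^ j * m) \<le> am_inf \<xi> (2 ^ i * m)"
      using double_le_am_inf[OF \<xi>, of "2 ^ i * m"] m Suc by (simp add: mult_ac)
    also have "\<dots> \<le> q ^ i * tail \<xi> m / (2 ^ i * real m)"
      using iterate_decay[of q 2 "tail \<xi>" m i] dec q m
      by (simp add: am_inf_eq divide_right_mono)
    also have "\<dots> = (q / 2) ^ i * am_inf \<xi> m" by (simp add: am_inf_eq power_divide)
    also have "\<dots> \<le> (q / 2) ^ i * (C * \<xi> m)" using bd[OF m] q by (intro mult_left_mono) auto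
    also have "\<dots> = 2 * C / q * (q / 2) ^ j * \<xi> m" using Suc q by (simp add: field_simps)
    also have "\<dots> \<le> C' * (q / 2) ^ j * \<xi> m"
      unfolding C'_def using q pos[OF m] by (intro mult_right_mono) auto
    finally show ?thesis .
  qed
  define p where "p = - log 2 (q / 2)"
  have p: "p > 1" using q by (simp add: p_def log_divide)
  have q2: "q / 2 = 2 powr (- p)" using q by (simp add: p_def)
  have "\<xi> n \<le> C' * 2 powr p * (real m / real n) powr p * \<xi> m" if m: "m \<ge> 1" and n: "n \<ge> m" for m n
  proof -
    have "n div m \<ge> 1" using m n by (simp add: Suc_le_eq div_greater_zero_iff)
    then obtain j where j: "2 ^ j \<le> n div m" "n div m < 2 ^ (j + 1)"
      using ex_power_ivl1[of 2 "n div m"] by auto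
    have lo: "2 ^ j * m \<le> n"
      using j(1) by (metis div_times_less_eq_dividend le_trans mult_le_mono1)
    have "n < 2 ^ (j + 1) * m" using j(2) m by (simp add: div_less_iff_less_mult)
    then have "real n < real (2 ^ (j + 1) * m)" by (simp only: of_nat_less_iff)
    then have hi: "real n / (2 * real m) \<le> 2 ^ j" using m by (simp add: field_simps)
    have "(q / 2) ^ j = (2 ^ j) powr (- p)"
      unfolding q2 by (simp add: powr_powr powr_realpow[symmetric] mult_ac)
    also have "\<dots> \<le> (real n / (2 * real m)) powr (- p)"
      using hi m n p by (intro powr_mono2') auto
    also have "\<dots> = 2 powr p * (real m / real n) powr p"
      using m n by (simp add: powr_divide powr_mult powr_minus field_simps)
    finally have "C' * (q / 2) ^ j * \<xi> m \<le> C' * (2 powr p * (real m / real n) powr p) * \<xi> m"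
      using C' pos[OF m] by (intro mult_right_mono mult_left_mono) auto
    moreover have "\<xi> n \<le> \<xi> (2 ^ j * m)" using lo m by (intro mono) auto
    ultimately show ?thesis using dyadic[OF m, of j] by (simp add: mult.assoc)
  qed
  then show ?thesis unfolding power_decay_def using p C'
    by (intro exI[of _ "C' * 2 powr p"] exI[of _ p]) auto
qed

lemma matuszewska_alpha_less_iff: "matuszewska_alpha \<xi> < -1 \<longleftrightarrow> power_decay \<xi>"
proof -
  have flip: "(real n / real m) powr (- p) = (real m / real n) powr p" for m n p
    by (simp add: powr_minus_divide powr_divide)
  have one: "(- 1 :: ereal) = ereal (- 1)" by (simp add: one_ereal_def)
  have "matuszewska_alpha \<xi> < -1 \<longleftrightarrow>
      (\<exists>\<gamma>< -1. \<exists>C>0. \<forall>m\<ge>1. \<forall>n\<ge>m. \<xi> n \<le> C * (real n / real m) powr \<gamma> * \<xi> m)"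
    unfolding matuszewska_alpha_def INF_less_iff one by auto
  also have "\<dots> \<longleftrightarrow> power_decay \<xi>"
  proof
    assume "\<exists>\<gamma>< -1. \<exists>C>0. \<forall>m\<ge>1. \<forall>n\<ge>m. \<xi> n \<le> C * (real n / real m) powr \<gamma> * \<xi> m"
    then obtain \<gamma> C where g: "\<gamma> < -1" "C > 0"
      "\<forall>m\<ge>1. \<forall>n\<ge>m. \<xi> n \<le> C * (real n / real m) powr \<gamma> * \<xi> m" by blast
    then have "\<forall>m\<ge>1. \<forall>n\<ge>m. \<xi> n \<le> C * (real m / real n) powr (- \<gamma>) * \<xi> m"
      by (simp add: flip[of _ _ \<gamma>])
    moreover have "- \<gamma> > 1" using g(1) by simp
    ultimately show "power_decay \<xi>" unfolding power_decay_def using g(2) by blast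
  next
    assume "power_decay \<xi>"
    then obtain C p where g: "C > 0" "p > 1"
      "\<forall>m\<ge>1. \<forall>n\<ge>m. \<xi> n \<le> C * (real m / real n) powr p * \<xi> m"
      unfolding power_decay_def by blast
    then have "\<forall>m\<ge>1. \<forall>n\<ge>m. \<xi> n \<le> C * (real n / real m) powr (- p) * \<xi> m"
      by (simp add: flip[of _ _ p])
    moreover have "- p < -1" using g(2) by simp
    ultimately show "\<exists>\<gamma>< -1. \<exists>C>0. \<forall>m\<ge>1. \<forall>n\<ge>m. \<xi> n \<le> C * (real n / real m) powr \<gamma> * \<xi> m"
      using g(1) by blast
  qed
  finally show ?thesis .
qed

section \<open>The infima of quotients\<close>

lemma le_equot_iff: "0 \<le> y \<Longrightarrow> 0 \<le> x \<Longrightarrow> ereal c \<le> equot x y \<longleftrightarrow> c * y \<le> x"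
  unfolding equot_def by (auto simp: le_divide_eq)

text \<open>The strict inequality leaves room for a uniform constant \<open>c\<close>. Cleared of denominators, the condition
  holds automatically where \<open>y n = 0\<close>, in agreement with the value \<open>\<infinity>\<close> of the quotient.\<close>

lemma less_INF_equot_iff:
  assumes "\<And>n. n \<ge> 1 \<Longrightarrow> 0 \<le> x n" "\<And>n. n \<ge> 1 \<Longrightarrow> 0 \<le> y n"
  shows "ereal r < (INF n\<in>{1..}. equot (x n) (y n)) \<longleftrightarrow> (\<exists>c>r. \<forall>n\<ge>1. c * y n \<le> x n)"
proof -
  have iff: "ereal c \<le> (INF n\<in>{1..}. equot (x n) (y n)) \<longleftrightarrow> (\<forall>n\<ge>1. c * y n \<le> x n)" for c
    unfolding le_INF_iff using assms by (auto simp: le_equot_iff)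
  show ?thesis
  proof
    assume "ereal r < (INF n\<in>{1..}. equot (x n) (y n))"
    then obtain c where c: "ereal r < ereal c" "ereal c < (INF n\<in>{1..}. equot (x n) (y n))"
      using ereal_dense2 by blast
    then show "\<exists>c>r. \<forall>n\<ge>1. c * y n \<le> x n" using iff[of c] less_imp_le by auto
  next
    assume "\<exists>c>r. \<forall>n\<ge>1. c * y n \<le> x n"
    then obtain c where c: "r < c" "ereal c \<le> (INF n\<in>{1..}. equot (x n) (y n))"
      using iff by blast
    have "ereal r < ereal c" using c(1) by simp
    also note c(2)
    finally show "ereal r < (INF n\<in>{1..}. equot (x n) (y n))" .
  qed
qed

lemma am_inf_quotient_iff_tail_decay:
  assumes \<xi>: "\<xi> \<in> l1_star" and k: "1 \<le> k"
  shows "ereal (real k) < (INF n\<in>{1..}. equot (am_inf \<xi> n) (am_inf \<xi> (k * n))) \<longleftrightarrow> tail_decay \<xi> k"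
proof -
  have eq: "c * am_inf \<xi> (k * n) \<le> am_inf \<xi> n \<longleftrightarrow> c / real k * tail \<xi> (k * n) \<le> tail \<xi> n"
    if "n \<ge> 1" for c n
    using that k by (simp add: am_inf_eq field_simps)
  have "ereal (real k) < (INF n\<in>{1..}. equot (am_inf \<xi> n) (am_inf \<xi> (k * n))) \<longleftrightarrow>
      (\<exists>c>real k. \<forall>n\<ge>1. c * am_inf \<xi> (k * n) \<le> am_inf \<xi> n)"
    using am_inf_nonneg[OF \<xi>] by (intro less_INF_equot_iff) auto
  also have "\<dots> \<longleftrightarrow> tail_decay \<xi> k"
    unfolding tail_decay_def
  proof
    assume "\<exists>c>real k. \<forall>n\<ge>1. c * am_inf \<xi> (k * n) \<le> am_inf \<xi> n"
    then obtain c where c: "c > real k" "\<And>n. n \<ge> 1 \<Longrightarrow> c / real k * tail \<xi> (k * n) \<le> tail \<xi> n"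
      using eq by blast
    then show "\<exists>q. 0 < q \<and> q < 1 \<and> (\<forall>n\<ge>1. tail \<xi> (k * n) \<le> q * tail \<xi> n)"
      using k by (intro exI[of _ "real k / c"]) (auto simp: field_simps)
  next
    assume "\<exists>q. 0 < q \<and> q < 1 \<and> (\<forall>n\<ge>1. tail \<xi> (k * n) \<le> q * tail \<xi> n)"
    then obtain q where q: "0 < q" "q < 1" "\<And>n. n \<ge> 1 \<Longrightarrow> tail \<xi> (k * n) \<le> q * tail \<xi> n"
      by blast
    have "(real k / q) * am_inf \<xi> (k * n) \<le> am_inf \<xi> n" if "n \<ge> 1" for n
      unfolding eq[OF that] using q(1) q(3)[OF that] k by (simp add: divide_le_eq mult.commute)
    moreover have "real k / q > real k" using q(1,2) k by (simp add: field_simps)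
    ultimately show "\<exists>c>real k. \<forall>n\<ge>1. c * am_inf \<xi> (k * n) \<le> am_inf \<xi> n" by blast
  qed
  finally show ?thesis .
qed

lemma sequence_quotient_iff_dilated_bound:
  assumes \<xi>: "\<xi> \<in> l1_star"
  shows "0 < (INF n\<in>{1..}. equot (\<xi> n) (am_inf \<xi> (k * n))) \<longleftrightarrow>
    (\<exists>C>0. \<forall>n\<ge>1. am_inf \<xi> (k * n) \<le> C * \<xi> n)"
proof -
  have "ereal 0 < (INF n\<in>{1..}. equot (\<xi> n) (am_inf \<xi> (k * n))) \<longleftrightarrow>
      (\<exists>c>0. \<forall>n\<ge>1. c * am_inf \<xi> (k * n) \<le> \<xi> n)"
    using am_inf_nonneg[OF \<xi>] c0_starD(1)[OF l1_starD(1)[OF \<xi>]]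
    by (intro less_INF_equot_iff) auto
  also have "\<dots> \<longleftrightarrow> (\<exists>C>0. \<forall>n\<ge>1. am_inf \<xi> (k * n) \<le> C * \<xi> n)"
  proof
    assume "\<exists>c>0. \<forall>n\<ge>1. c * am_inf \<xi> (k * n) \<le> \<xi> n"
    then obtain c where "c > 0" "\<forall>n\<ge>1. c * am_inf \<xi> (k * n) \<le> \<xi> n" by blast
    then show "\<exists>C>0. \<forall>n\<ge>1. am_inf \<xi> (k * n) \<le> C * \<xi> n"
      by (intro exI[of _ "1 / c"]) (auto simp: field_simps)
  next
    assume "\<exists>C>0. \<forall>n\<ge>1. am_inf \<xi> (k * n) \<le> C * \<xi> n"
    then obtain C where "C > 0" "\<forall>n\<ge>1. am_inf \<xi> (k * n) \<le> C * \<xi> n" by blast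
    then show "\<exists>c>0. \<forall>n\<ge>1. c * am_inf \<xi> (k * n) \<le> \<xi> n"
      by (intro exI[of _ "1 / C"]) (auto simp: field_simps)
  qed
  finally show ?thesis by (simp add: zero_ereal_def)
qed

text \<open>An infinite supremum gives an infimum above \<open>1\<close>, which is decay for one \<open>k\<close>; conversely,
  decay for \<open>k\<close> iterates to decay with ratio \<open>q\<^sup>j\<close> for \<open>k\<^sup>j\<close>.\<close>

lemma SUP_quotient_iff_tail_decay:
  assumes \<xi>: "\<xi> \<in> l1_star"
  shows "(SUP k\<in>{1::nat..}. INF n\<in>{1..}. equot (am_inf \<xi> n) (real k * am_inf \<xi> (k * n))) = \<infinity>
    \<longleftrightarrow> (\<exists>k\<ge>1. tail_decay \<xi> k)"
proof -
  have iff: "ereal r < (INF n\<in>{1..}. equot (am_inf \<xi> n) (real k * am_inf \<xi> (k * n))) \<longleftrightarrow>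
      (\<exists>c>r. \<forall>n\<ge>1. c * tail \<xi> (k * n) \<le> tail \<xi> n)" if k: "k \<ge> 1" for r k
  proof -
    have "c * (real k * am_inf \<xi> (k * n)) \<le> am_inf \<xi> n \<longleftrightarrow> c * tail \<xi> (k * n) \<le> tail \<xi> n"
      if "n \<ge> 1" for c n
      using that k by (simp add: am_inf_eq field_simps)
    moreover have "ereal r < (INF n\<in>{1..}. equot (am_inf \<xi> n) (real k * am_inf \<xi> (k * n))) \<longleftrightarrow>
      (\<exists>c>r. \<forall>n\<ge>1. c * (real k * am_inf \<xi> (k * n)) \<le> am_inf \<xi> n)"
      using am_inf_nonneg[OF \<xi>] by (intro less_INF_equot_iff) auto
    ultimately show ?thesis by auto
  qed
  show ?thesis
  proof
    assume "(SUP k\<in>{1::nat..}. INF n\<in>{1..}. equot (am_inf \<xi> n) (real k * am_inf \<xi> (k * n))) = \<infinity>"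
    then have "ereal 1 < (SUP k\<in>{1::nat..}. INF n\<in>{1..}. equot (am_inf \<xi> n) (real k * am_inf \<xi> (k * n)))"
      by simp
    then obtain k where k: "k \<ge> 1" "ereal 1 < (INF n\<in>{1..}. equot (am_inf \<xi> n) (real k * am_inf \<xi> (k * n)))"
      unfolding less_SUP_iff by auto
    then obtain c where c: "c > 1" "\<And>n. n \<ge> 1 \<Longrightarrow> c * tail \<xi> (k * n) \<le> tail \<xi> n"
      using iff[OF k(1)] by blast
    then have "tail_decay \<xi> k"
      unfolding tail_decay_def by (intro exI[of _ "1 / c"]) (auto simp: field_simps)
    then show "\<exists>k\<ge>1. tail_decay \<xi> k" using k(1) by blast
  next
    assume "\<exists>k\<ge>1. tail_decay \<xi> k"
    then obtain k q where k: "k \<ge> 1" and q: "0 < q" "q < 1"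
      and dec: "\<And>n. n \<ge> 1 \<Longrightarrow> tail \<xi> (k * n) \<le> q * tail \<xi> n"
      unfolding tail_decay_def by blast
    show "(SUP k\<in>{1::nat..}. INF n\<in>{1..}. equot (am_inf \<xi> n) (real k * am_inf \<xi> (k * n))) = \<infinity>"
    proof (rule SUP_PInfty)
      fix N :: nat
      obtain j where j: "q ^ j < 1 / (real N + 1)"
        using real_arch_pow_inv[of "1 / (real N + 1)" q] q by auto
      have "(real N + 1) * tail \<xi> (k ^ j * n) \<le> tail \<xi> n" if n: "n \<ge> 1" for n
      proof -
        have "tail \<xi> (k ^ j * n) \<le> q ^ j * tail \<xi> n"
          using iterate_decay[of q k "tail \<xi>" n j] q k dec n by simp
        also have "\<dots> \<le> 1 / (real N + 1) * tail \<xi> n"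
          using j tail_nonneg[OF \<xi>] by (intro mult_right_mono) auto
        finally show ?thesis by (simp add: field_simps)
      qed
      then have "ereal (real N) < (INF n\<in>{1..}. equot (am_inf \<xi> n) (real (k ^ j) * am_inf \<xi> (k ^ j * n)))"
        using k by (subst iff) (auto intro!: exI[of _ "real N + 1"])
      then show "\<exists>i\<in>{1..}. ereal (real N) \<le> (INF n\<in>{1..}. equot (am_inf \<xi> n) (real i * am_inf \<xi> (i * n)))"
        using k by (intro bexI[of _ "k ^ j"]) auto
    qed
  qed
qed

section \<open>Regularity at infinity\<close>

lemma tail_bounded_of_dominated_am_inf:
  assumes \<xi>: "\<xi> \<in> l1_star" and d: "dominated (am_inf \<xi>) \<xi>"
  shows "tail_bounded \<xi>"
proof -
  obtain m C where m: "m \<ge> 1" and C: "C > 0" and bd: "\<And>n. n \<ge> 1 \<Longrightarrow> am_inf \<xi> (m * n) \<le> C * \<xi> n"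
    using d unfolding dominated_def by blast
  have "tail_decay \<xi> (2 * m)" by (rule tail_decay_of_dilated_bound[OF \<xi> m C bd])
  then show ?thesis by (rule tail_bounded_of_tail_decay[OF \<xi>]) (use m in simp)
qed

lemma dominated_of_dominated_am_inf:
  assumes \<eta>: "\<eta> \<in> l1_star" and d: "dominated (am_inf \<eta>) \<xi>"
  shows "dominated \<eta> \<xi>"
proof -
  obtain m C where m: "m \<ge> 1" and C: "C > 0" and bd: "\<And>n. n \<ge> 1 \<Longrightarrow> am_inf \<eta> (m * n) \<le> C * \<xi> n"
    using d unfolding dominated_def by blast
  have "\<eta> (2 * m * n) \<le> C * \<xi> n" if "n \<ge> 1" for n
    using double_le_am_inf[OF \<eta>, of "m * n"] bd[OF that] m that by (simp add: mult.assoc)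
  then show ?thesis unfolding dominated_def using m C
    by (intro exI[of _ "2 * m"] conjI exI[of _ C]) auto
qed

lemma dominated_am_inf:
  assumes \<eta>: "\<eta> \<in> c0_star" and \<xi>: "\<xi> \<in> l1_star" and b: "tail_bounded \<xi>" and d: "dominated \<eta> \<xi>"
  shows "\<eta> \<in> l1_star" "dominated (am_inf \<eta>) \<xi>"
proof -
  obtain m C where m: "m \<ge> 1" and C: "C > 0" and bd: "\<And>n. n \<ge> 1 \<Longrightarrow> \<eta> (m * n) \<le> C * \<xi> n"
    using d unfolding dominated_def by blast
  obtain A where A: "A > 0" and Ab: "\<And>n. n \<ge> 1 \<Longrightarrow> am_inf \<xi> n \<le> A * \<xi> n"
    using b unfolding tail_bounded_def by blast
  have C0: "0 \<le> C" using C by simp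
  note T = tail_dilated[OF \<eta> \<xi> m C0 bd]
  show "\<eta> \<in> l1_star" by (rule T(1))
  have "am_inf \<eta> (m * n) \<le> C * (1 + A) * \<xi> n" if n: "n \<ge> 1" for n
  proof -
    have "tail \<xi> n \<le> real n * (A * \<xi> n)"
      using Ab[OF n] n by (simp add: am_inf_eq divide_le_eq mult_ac)
    moreover have "\<xi> n \<le> real n * \<xi> n"
      using mult_right_mono[of 1 "real n" "\<xi> n"] n c0_starD(1)[OF l1_starD(1)[OF \<xi>] n] by simp
    ultimately have "\<xi> n + tail \<xi> n \<le> real n * ((1 + A) * \<xi> n)" by (simp add: algebra_simps)
    then have "tail \<eta> (m * n) \<le> C * real m * (real n * ((1 + A) * \<xi> n))"
      using T(2)[OF _ n] C m by (smt (verit) mult_left_mono mult_nonneg_nonneg of_nat_0_le_iff)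
    then show ?thesis using m n by (simp add: am_inf_eq divide_le_eq mult_ac)
  qed
  then show "dominated (am_inf \<eta>) \<xi>" unfolding dominated_def using m C A
    by (intro exI[of _ m] conjI exI[of _ "C * (1 + A)"]) auto
qed

text \<open>Regularity is an equality of characteristic sets. It forces \<open>am_inf \<xi>\<close> into the set of
  \<open>(\<xi>)\<close>, because \<open>\<xi>\<close> belongs to it; and if tails are bounded, domination by \<open>\<xi>\<close> passes from \<open>\<eta>\<close> to \<open>am_inf \<eta>\<close> and back.\<close>

lemma infty_regular_iff_tail_bounded:
  assumes b: "orthonormal_basis b" and \<xi>: "\<xi> \<in> l1_star"
  shows "infty_regular b \<xi> \<longleftrightarrow> tail_bounded \<xi>"
proof -
  note c = l1_starD(1)[OF \<xi>]
  have o: "orthonormal_seq b" using b unfolding orthonormal_basis_def by blast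
  show ?thesis
  proof (cases "\<xi> 1 = 0")
    case True
    have z: "\<xi> n = 0" if "n \<ge> 1" for n
      using c0_starD(1)[OF c that] c0_starD(2)[OF c _ that] True by simp
    have "tail_bounded \<xi>"
      unfolding tail_bounded_def by (intro exI[of _ 1]) (simp add: am_inf_def z)
    then show ?thesis unfolding infty_regular_def using \<xi> z by blast
  next
    case False
    then have pos: "\<xi> 1 > 0" using c0_starD(1)[OF c, of 1] by simp
    have "infty_regular b \<xi> \<longleftrightarrow>
        {\<sigma> \<in> c0_star. dominated \<sigma> \<xi>} = {\<eta> \<in> l1_star. am_inf \<eta> \<in> c0_star \<and> dominated (am_inf \<eta>) \<xi>}"
      unfolding infty_regular_def is_am_inf_ideal_def char_set_principal[OF b c pos]
      using proper_ideal_principal[OF o c] \<xi> False by auto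
    also have "\<dots> \<longleftrightarrow> tail_bounded \<xi>"
    proof
      have "dominated \<xi> \<xi>"
        unfolding dominated_def by (intro exI[of _ 1] conjI) auto
      moreover assume "{\<sigma> \<in> c0_star. dominated \<sigma> \<xi>} = {\<eta> \<in> l1_star. am_inf \<eta> \<in> c0_star \<and> dominated (am_inf \<eta>) \<xi>}"
      ultimately have "dominated (am_inf \<xi>) \<xi>" using c by blast
      then show "tail_bounded \<xi>" by (rule tail_bounded_of_dominated_am_inf[OF \<xi>])
    next
      assume "tail_bounded \<xi>"
      then show "{\<sigma> \<in> c0_star. dominated \<sigma> \<xi>} = {\<eta> \<in> l1_star. am_inf \<eta> \<in> c0_star \<and> dominated (am_inf \<eta>) \<xi>}"
        using dominated_am_inf[OF _ \<xi>] dominated_of_dominated_am_inf am_inf_c0_star l1_starD(1)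
        by blast
    qed
    finally show ?thesis .
  qed
qed

lemma tail_bounded_am_inf:
  assumes \<xi>: "\<xi> \<in> l1_star" and b: "tail_bounded \<xi>"
  shows "am_inf \<xi> \<in> l1_star" "tail_bounded (am_inf \<xi>)"
proof -
  obtain C where C: "C > 0" and bd: "\<And>n. n \<ge> 1 \<Longrightarrow> am_inf \<xi> n \<le> C * \<xi> n"
    using b unfolding tail_bounded_def by blast
  have "summable (am_inf \<xi>)"
    by (rule summable_comparison_test'[OF summable_mult[OF l1_starD(2)[OF \<xi>], of C], where N = 1])
       (use bd am_inf_nonneg[OF \<xi>] in auto)
  then show \<eta>: "am_inf \<xi> \<in> l1_star"
    using am_inf_c0_star[OF \<xi>] unfolding l1_star_def by blast
  have "am_inf (am_inf \<xi>) n \<le> C * am_inf \<xi> n" for n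
  proof -
    have "tail (am_inf \<xi>) n \<le> (\<Sum>j. C * \<xi> (j + Suc n))"
      unfolding tail_def by (intro suminf_le bd summable_mult summable_tail \<xi> \<eta>) auto
    also have "\<dots> = C * tail \<xi> n"
      unfolding tail_def by (rule suminf_mult[OF summable_tail[OF \<xi>]])
    finally show ?thesis unfolding am_inf_eq[of "am_inf \<xi>"] am_inf_eq[of \<xi>]
      using divide_right_mono[of _ _ "real n"] by fastforce
  qed
  then show "tail_bounded (am_inf \<xi>)" unfolding tail_bounded_def using C by blast
qed

text \<open>The converse of the previous lemma costs more, since a bound on the tails of \<open>am_inf \<xi>\<close> says
  nothing directly about \<open>\<xi>\<close>. But then the tails \<open>S\<^sub>n\<close> of \<open>am_inf \<xi>\<close> decay geometrically, and up to constants the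
  tail of \<open>\<xi>\<close> at \<open>2 n\<close> is at most \<open>S\<^sub>n\<close> and \<open>S\<^sub>n\<close> is at most the tail of \<open>\<xi>\<close> at \<open>n\<close>. Hence the tails of \<open>\<xi>\<close> decay too.\<close>

lemma tail_bounded_of_am_inf:
  assumes \<xi>: "\<xi> \<in> l1_star" and \<eta>: "am_inf \<xi> \<in> l1_star" and b: "tail_bounded (am_inf \<xi>)"
  shows "tail_bounded \<xi>"
proof -
  let ?S = "tail (am_inf \<xi>)"
  obtain C where C: "C > 0" and bd: "\<And>n. n \<ge> 1 \<Longrightarrow> am_inf (am_inf \<xi>) n \<le> C * am_inf \<xi> n"
    using b unfolding tail_bounded_def by blast
  obtain q where q: "0 < q" "q < 1" and dec: "\<And>n. n \<ge> 1 \<Longrightarrow> ?S (2 * n) \<le> q * ?S n"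
    using tail_decay_of_tail_bounded[OF \<eta> b, of 2] unfolding tail_decay_def by auto
  obtain j where j: "q ^ j < 1 / (2 * C)"
    using real_arch_pow_inv[of "1 / (2 * C)" q] q C by auto
  have "tail \<xi> (2 ^ Suc j * n) \<le> (2 * C * q ^ j) * tail \<xi> n" if n: "n \<ge> 1" for n
  proof -
    have "am_inf \<xi> (2 * (2 ^ j * n)) \<le> am_inf (am_inf \<xi>) (2 ^ j * n)"
      using n by (intro double_le_am_inf[OF \<eta>]) auto
    then have "tail \<xi> (2 ^ Suc j * n) \<le> 2 * ?S (2 ^ j * n)"
      using n by (simp add: am_inf_eq[of "am_inf \<xi>"] am_inf_eq[of \<xi>] divide_simps mult_ac)
    also have "\<dots> \<le> 2 * (q ^ j * ?S n)"
      using iterate_decay[of q 2 ?S n j] q dec n by simp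
    also have "?S n \<le> C * tail \<xi> n"
      using bd[OF n] n by (simp add: am_inf_eq[of "am_inf \<xi>"] am_inf_eq[of \<xi>] divide_simps)
    finally show ?thesis using q by (simp add: mult_left_mono mult_ac)
  qed
  moreover have "2 * C * q ^ j < 1" "0 < 2 * C * q ^ j" using j C q by (simp_all add: field_simps)
  ultimately have "tail_decay \<xi> (2 ^ Suc j)" unfolding tail_decay_def by blast
  then show ?thesis by (rule tail_bounded_of_tail_decay[OF \<xi>]) simp
qed

theorem theorem4p12:
  fixes \<xi> :: "nat \<Rightarrow> real" and b :: "nat \<Rightarrow> 'h::complex_hilbert"
  assumes "orthonormal_basis b"
    and "\<xi> \<in> l1_star"
  shows "(infty_regular b \<xi> \<longleftrightarrow> am_inf \<xi> \<in> O(\<xi>)) \<and>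
    (infty_regular b \<xi> \<longleftrightarrow> matuszewska_alpha \<xi> < -1) \<and>
    (infty_regular b \<xi> \<longleftrightarrow>
       (\<exists>C::real. \<exists>p::real. C > 0 \<and> p > 1 \<and>
          (\<forall>m\<ge>1. \<forall>n\<ge>m. \<xi> n \<le> C * (real m / real n) powr p * \<xi> m))) \<and>
    (infty_regular b \<xi> \<longleftrightarrow> infty_regular b (am_inf \<xi>)) \<and>
    (infty_regular b \<xi> \<longleftrightarrow>
       (\<exists>k::nat. k > 1 \<and> (INF n\<in>{1..}. equot (am_inf \<xi> n) (am_inf \<xi> (k * n))) > ereal (real k))) \<and>
    (infty_regular b \<xi> \<longleftrightarrow>
       (\<forall>k::nat. k > 1 \<longrightarrow> (INF n\<in>{1..}. equot (am_inf \<xi> n) (am_inf \<xi> (k * n))) > ereal (real k))) \<and>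
    (infty_regular b \<xi> \<longleftrightarrow>
       (\<forall>k::nat. k > 1 \<longrightarrow> (INF n\<in>{1..}. equot (\<xi> n) (am_inf \<xi> (k * n))) > 0)) \<and>
    (infty_regular b \<xi> \<longleftrightarrow>
       (\<exists>k::nat. k > 1 \<and> (INF n\<in>{1..}. equot (\<xi> n) (am_inf \<xi> (k * n))) > 0)) \<and>
    (infty_regular b \<xi> \<longleftrightarrow>
       (SUP k\<in>{1::nat..}. INF n\<in>{1..}. equot (am_inf \<xi> n) (real k * am_inf \<xi> (k * n))) = \<infinity>)"
proof -
  note \<xi> = assms(2)
  have reg: "infty_regular b \<xi> \<longleftrightarrow> tail_bounded \<xi>"
    by (rule infty_regular_iff_tail_bounded[OF assms])
  have pow: "tail_bounded \<xi> \<longleftrightarrow> power_decay \<xi>"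
    using tail_bounded_of_power_decay[OF \<xi>] power_decay_of_tail_bounded[OF \<xi>] by blast
  have iv: "tail_bounded \<xi> \<longleftrightarrow> infty_regular b (am_inf \<xi>)"
  proof
    assume "tail_bounded \<xi>"
    then show "infty_regular b (am_inf \<xi>)"
      using tail_bounded_am_inf[OF \<xi>] infty_regular_iff_tail_bounded[OF assms(1)] by blast
  next
    assume r: "infty_regular b (am_inf \<xi>)"
    then have "am_inf \<xi> \<in> l1_star" unfolding infty_regular_def by blast
    then show "tail_bounded \<xi>"
      using r tail_bounded_of_am_inf[OF \<xi>] infty_regular_iff_tail_bounded[OF assms(1)] by blast
  qed
  have two: "(1::nat) < 2" by simp
  have up: "tail_bounded \<xi>" if "tail_decay \<xi> k" "k > 1" for k
    using tail_bounded_of_tail_decay[OF \<xi> that(1)] that(2) by simp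
  have down: "tail_decay \<xi> k" if "tail_bounded \<xi>" "k > 1" for k
    by (rule tail_decay_of_tail_bounded[OF \<xi> that])
  have dec: "tail_bounded \<xi> \<longleftrightarrow> (\<exists>k>1. tail_decay \<xi> k)"
    by (metis up down two)
  have dec_all: "tail_bounded \<xi> \<longleftrightarrow> (\<forall>k>1. tail_decay \<xi> k)"
    by (metis up down two)
  have dec_ge: "tail_bounded \<xi> \<longleftrightarrow> (\<exists>k\<ge>1. tail_decay \<xi> k)"
    by (metis down two tail_bounded_of_tail_decay[OF \<xi>] one_le_numeral)
  have dil: "\<exists>C>0. \<forall>n\<ge>1. am_inf \<xi> (k * n) \<le> C * \<xi> n" if b: "tail_bounded \<xi>" and k: "k > 1" for k
  proof -
    obtain C where C: "C > 0" "\<And>n. n \<ge> 1 \<Longrightarrow> am_inf \<xi> n \<le> C * \<xi> n"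
      using b unfolding tail_bounded_def by blast
    have "am_inf \<xi> (k * n) \<le> C * \<xi> n" if "n \<ge> 1" for n
      using am_inf_antimono[OF \<xi> that, of "k * n"] C(2)[OF that] k by simp
    then show ?thesis using C(1) by blast
  qed
  have dil': "tail_bounded \<xi>" if "\<exists>C>0. \<forall>n\<ge>1. am_inf \<xi> (k * n) \<le> C * \<xi> n" "k > 1" for k
  proof (rule tail_bounded_of_dominated_am_inf[OF \<xi>])
    show "dominated (am_inf \<xi>) \<xi>"
      unfolding dominated_def using that by (intro exI[of _ k]) auto
  qed
  have quot: "ereal (real k) < (INF n\<in>{1..}. equot (am_inf \<xi> n) (am_inf \<xi> (k * n))) \<longleftrightarrow> tail_decay \<xi> k"
    if "k > 1" for k
    using am_inf_quotient_iff_tail_decay[OF \<xi>, of k] that by simp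
  have v: "tail_bounded \<xi> \<longleftrightarrow>
      (\<exists>k::nat. k > 1 \<and> (INF n\<in>{1..}. equot (am_inf \<xi> n) (am_inf \<xi> (k * n))) > ereal (real k))"
    unfolding dec using quot by blast
  have v': "tail_bounded \<xi> \<longleftrightarrow>
      (\<forall>k::nat. k > 1 \<longrightarrow> (INF n\<in>{1..}. equot (am_inf \<xi> n) (am_inf \<xi> (k * n))) > ereal (real k))"
    unfolding dec_all using quot by blast
  have v'': "tail_bounded \<xi> \<longleftrightarrow> (\<forall>k::nat. k > 1 \<longrightarrow> (INF n\<in>{1..}. equot (\<xi> n) (am_inf \<xi> (k * n))) > 0)"
    unfolding sequence_quotient_iff_dilated_bound[OF \<xi>]
    by (metis dil dil' two)
  have v''': "tail_bounded \<xi> \<longleftrightarrow> (\<exists>k::nat. k > 1 \<and> (INF n\<in>{1..}. equot (\<xi> n) (am_inf \<xi> (k * n))) > 0)"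
    unfolding sequence_quotient_iff_dilated_bound[OF \<xi>]
    by (metis dil dil' two)
  show ?thesis
    unfolding reg
    by (intro conjI bigo_iff_tail_bounded[OF \<xi>, symmetric] pow[folded matuszewska_alpha_less_iff]
        pow[unfolded power_decay_def] iv v v' v'' v'''
        dec_ge[folded SUP_quotient_iff_tail_decay[OF \<xi>]])
qed

end
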